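(* Let $X$ be an infinite uniformly locally finite metric space, let $(n_k)_{k\in\mathbb{N}}$ be a sequence of natural numbers that tends to infinity, and let $\mathcal{M}=\prod_k\mathrm{M}_{n_k}(\mathbb{C})$. Let $\Phi:\mathcal{M}\to\mathrm{C}^*_{ql}(X)$ be an injective $*$-homomorphism (not assumed unital or normal) such that $\Phi(a)$ is a ghost operator for every $a\in\bigoplus_k\mathrm{M}_{n_k}(\mathbb{C})$. Then $\Phi(a)$ is a ghost operator for every $a\in\mathcal{M}$.
   Context: A metric space $X$ is uniformly locally finite if for each $r>0$ one has $\sup_{x\in X}|B_r(x)|<\infty$, where $B_r(x)$ is the closed ball of radius $r$. $\ell_2(X)$ is the complex Hilbert space of square-summable functions on $X$ with orthonormal basis $(\delta_x)_{x\in X}$; for $A\subseteq X$, $\chi_A\in\mathcal{B}(\ell_2(X))$ is the orthogonal projection onto $\ell_2(A)$; $d(A,B)=\inf\{d(x,y): x\in A, y\in B\}$. The quasi-local algebra $\mathrm{C}^*_{ql}(X)$ is the $\mathrm{C}^*$-algebra of all $a\in\mathcal{B}(\ell_2(X))$ such that for every $\varepsilon>0$ there is $r>0$ such that for all $A,B\subseteq X$ with $d(A,B)>r$ one has $\|\chi_A a\chi_B\|\le\varepsilon$. An operator $a\in\mathcal{B}(\ell_2(X))$ is a ghost if for every $\varepsilon>0$ there is a finite $F\subseteq X$ such that $\|a\delta_x\|<\varepsilon$ whenever $x\notin F$. $\prod_k$ denotes the $\ell_\infty$-direct sum and $\bigoplus_k$ the $c_0$-direct sum of $\mathrm{C}^*$-algebras.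 *)

theory Defs
  imports "HOL-Analysis.Analysis" "Jordan_Normal_Form.Schur_Decomposition"
begin

subsection \<open>The Hilbert space of square-summable functions\<close>

typedef 'a ell2 = "{f :: 'a \<Rightarrow> complex. (\<lambda>x. (cmod (f x))\<^sup>2) summable_on UNIV}"
  morphisms ell2_apply Abs_ell2
  by (rule exI[of _ "\<lambda>_. 0"]) simp

setup_lifting type_definition_ell2

lemma ell2_summable: "(\<lambda>x. (cmod (ell2_apply f x))\<^sup>2) summable_on UNIV"
  using ell2_apply[of f] by simp

lemma square_summable_product:
  fixes f g :: "'a \<Rightarrow> complex"
  assumes f: "(\<lambda>x. (cmod (f x))\<^sup>2) summable_on UNIV"
    and g: "(\<lambda>x. (cmod (g x))\<^sup>2) summable_on UNIV"
  shows "(\<lambda>x. f x * cnj (g x)) summable_on UNIV"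
proof -
  have "(\<lambda>x. norm (f x * cnj (g x))) summable_on UNIV"
  proof (rule summable_on_comparison_test[OF summable_on_add[OF f g]])
    fix x
    have "0 \<le> (cmod (f x) - cmod (g x))\<^sup>2" by simp
    then have "2 * (cmod (f x) * cmod (g x)) \<le> (cmod (f x))\<^sup>2 + (cmod (g x))\<^sup>2"
      unfolding power2_diff by linarith
    moreover have "0 \<le> cmod (f x) * cmod (g x)" by (intro mult_nonneg_nonneg norm_ge_zero)
    ultimately have "cmod (f x) * cmod (g x) \<le> (cmod (f x))\<^sup>2 + (cmod (g x))\<^sup>2" by linarith
    then show "norm (f x * cnj (g x)) \<le> (cmod (f x))\<^sup>2 + (cmod (g x))\<^sup>2" unfolding norm_mult complex_mod_cnj .
  qed (rule norm_ge_zero)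
  then show ?thesis by (rule abs_summable_summable)
qed

lemma square_summable_add:
  fixes f g :: "'a \<Rightarrow> complex"
  assumes f: "(\<lambda>x. (cmod (f x))\<^sup>2) summable_on UNIV"
    and g: "(\<lambda>x. (cmod (g x))\<^sup>2) summable_on UNIV"
  shows "(\<lambda>x. (cmod (f x + g x))\<^sup>2) summable_on UNIV"
proof (rule summable_on_comparison_test)
  show "(\<lambda>x. 2 * (cmod (f x))\<^sup>2 + 2 * (cmod (g x))\<^sup>2) summable_on UNIV"
    by (intro summable_on_add summable_on_cmult_right f g)
  fix x
  have "(cmod (f x + g x))\<^sup>2 \<le> (cmod (f x) + cmod (g x))\<^sup>2"
    by (intro power_mono norm_triangle_ineq) simp
  moreover have "0 \<le> (cmod (f x) - cmod (g x))\<^sup>2" by simp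
  ultimately show "(cmod (f x + g x))\<^sup>2 \<le> 2 * (cmod (f x))\<^sup>2 + 2 * (cmod (g x))\<^sup>2"
    unfolding power2_diff power2_sum by linarith
qed (rule zero_le_power2)

lemma square_summable_scale:
  fixes f :: "'a \<Rightarrow> complex"
  assumes "(\<lambda>x. (cmod (f x))\<^sup>2) summable_on UNIV"
  shows "(\<lambda>x. (cmod (c * f x))\<^sup>2) summable_on UNIV"
  using summable_on_cmult_right[OF assms, of "(cmod c)\<^sup>2"] by (simp add: norm_mult power_mult_distrib)

lift_definition scaleC :: "complex \<Rightarrow> 'a ell2 \<Rightarrow> 'a ell2" (infixr "*\<^sub>C" 75)
  is "\<lambda>c f x. c * f x" by (rule square_summable_scale)

definition cinner :: "'a ell2 \<Rightarrow> 'a ell2 \<Rightarrow> complex" where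
  "cinner f g = (\<Sum>\<^sub>\<infinity>x. ell2_apply f x * cnj (ell2_apply g x))"

lemma cinner_self_infsum: "cinner f f = complex_of_real (\<Sum>\<^sub>\<infinity>x. (cmod (ell2_apply f x))\<^sup>2)"
proof -
  have "cinner f f = (\<Sum>\<^sub>\<infinity>x. complex_of_real ((cmod (ell2_apply f x))\<^sup>2))"
    unfolding cinner_def complex_norm_square by simp
  also have "\<dots> = complex_of_real (\<Sum>\<^sub>\<infinity>x. (cmod (ell2_apply f x))\<^sup>2)"
    by (intro infsumI has_sum_of_real has_sum_infsum ell2_summable)
  finally show ?thesis .
qed

text \<open>The underlying real inner product is the real part of \<^const>\<open>cinner\<close>; both induce the
  same norm (lemma \<open>cinner_self\<close> below).\<close>

instantiation ell2 :: (type) real_vector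
begin

lift_definition zero_ell2 :: "'a ell2" is "\<lambda>_. 0" by simp
lift_definition plus_ell2 :: "'a ell2 \<Rightarrow> 'a ell2 \<Rightarrow> 'a ell2" is "\<lambda>f g x. f x + g x"
  by (rule square_summable_add)
lift_definition uminus_ell2 :: "'a ell2 \<Rightarrow> 'a ell2" is "\<lambda>f x. - f x" by simp
definition minus_ell2 :: "'a ell2 \<Rightarrow> 'a ell2 \<Rightarrow> 'a ell2" where "minus_ell2 f g = f + - g"
definition scaleR_ell2 :: "real \<Rightarrow> 'a ell2 \<Rightarrow> 'a ell2" where "scaleR_ell2 r f = complex_of_real r *\<^sub>C f"

instance
proof
  fix f g h :: "'a ell2" and r s :: real
  show "f + g + h = f + (g + h)" by transfer (simp add: add.assoc)
  show "f + g = g + f" by transfer (simp add: add.commute)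
  show "0 + f = f" by transfer simp
  show "- f + f = 0" by transfer simp
  show "f - g = f + - g" by (rule minus_ell2_def)
  show "r *\<^sub>R (f + g) = r *\<^sub>R f + r *\<^sub>R g"
    unfolding scaleR_ell2_def by transfer (simp add: algebra_simps)
  show "(r + s) *\<^sub>R f = r *\<^sub>R f + s *\<^sub>R f"
    unfolding scaleR_ell2_def by transfer (simp add: algebra_simps)
  show "r *\<^sub>R s *\<^sub>R f = (r * s) *\<^sub>R f"
    unfolding scaleR_ell2_def by transfer (simp add: algebra_simps)
  show "1 *\<^sub>R f = f" unfolding scaleR_ell2_def by transfer simp
qed

end

instantiation ell2 :: (type) real_inner
begin

definition inner_ell2 :: "'a ell2 \<Rightarrow> 'a ell2 \<Rightarrow> real" where "inner_ell2 f g = Re (cinner f g)"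
definition norm_ell2 :: "'a ell2 \<Rightarrow> real"
  where "norm_ell2 f = sqrt (\<Sum>\<^sub>\<infinity>x. (cmod (ell2_apply f x))\<^sup>2)"
definition dist_ell2 :: "'a ell2 \<Rightarrow> 'a ell2 \<Rightarrow> real" where "dist_ell2 f g = norm (f - g)"
definition sgn_ell2 :: "'a ell2 \<Rightarrow> 'a ell2" where "sgn_ell2 f = inverse (norm f) *\<^sub>R f"
definition uniformity_ell2 :: "('a ell2 \<times> 'a ell2) filter"
  where "uniformity_ell2 = (INF e\<in>{0<..}. principal {(x, y). dist x y < e})"
definition open_ell2 :: "'a ell2 set \<Rightarrow> bool"
  where "open_ell2 U = (\<forall>x\<in>U. eventually (\<lambda>(x', y). x' = x \<longrightarrow> y \<in> U) uniformity)"

instance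
proof
  fix f g h :: "'a ell2" and r s :: real
  have prod: "(\<lambda>x. ell2_apply f x * cnj (ell2_apply g x)) summable_on UNIV" for f g :: "'a ell2"
    by (intro square_summable_product ell2_summable)
  note self = cinner_self_infsum
  show "dist f g = norm (f - g)" by (rule dist_ell2_def)
  show "sgn f = f /\<^sub>R norm f" by (rule sgn_ell2_def)
  show "uniformity = (INF e\<in>{0<..}. principal {(x :: 'a ell2, y). dist x y < e})"
    by (rule uniformity_ell2_def)
  show "open U = (\<forall>x\<in>U. \<forall>\<^sub>F (x', y) in uniformity. x' = x \<longrightarrow> y \<in> U)" for U :: "'a ell2 set"
    by (rule open_ell2_def)
  show "inner f g = inner g f"
  proof -
    have "cnj (cinner f g) = (\<Sum>\<^sub>\<infinity>x. cnj (ell2_apply f x * cnj (ell2_apply g x)))"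
      unfolding cinner_def by (rule infsum_cnj[symmetric])
    also have "\<dots> = cinner g f" unfolding cinner_def by (simp add: mult.commute)
    finally have "cinner g f = cnj (cinner f g)" by simp
    then show ?thesis by (simp add: inner_ell2_def)
  qed
  show "inner (f + g) h = inner f h + inner g h"
    unfolding inner_ell2_def cinner_def
    by (simp add: plus_ell2.rep_eq distrib_right infsum_add[OF prod prod])
  show "inner (r *\<^sub>R f) g = r * inner f g"
    unfolding inner_ell2_def cinner_def scaleR_ell2_def
    by (simp add: scaleC.rep_eq mult.assoc infsum_cmult_right')
  show "0 \<le> inner f f"
    unfolding inner_ell2_def self by (simp add: infsum_nonneg)
  show "(inner f f = 0) = (f = 0)"
  proof
    assume "inner f f = 0"
    then have "(\<Sum>\<^sub>\<infinity>x. (cmod (ell2_apply f x))\<^sup>2) = 0" unfolding inner_ell2_def self by simp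
    then have "(cmod (ell2_apply f x))\<^sup>2 = 0" for x
      using nonneg_infsum_le_0D[OF _ ell2_summable[of f], of x] by simp
    then have "ell2_apply f = ell2_apply 0" by (auto simp: zero_ell2.rep_eq)
    then show "f = 0" by (simp add: ell2_apply_inject)
  next
    assume "f = 0"
    then show "inner f f = 0" unfolding inner_ell2_def self by (simp add: zero_ell2.rep_eq)
  qed
  show "norm f = sqrt (inner f f)" unfolding norm_ell2_def inner_ell2_def self by simp
qed

end

lemma norm_ell2_square: "(norm f)\<^sup>2 = (\<Sum>\<^sub>\<infinity>x. (cmod (ell2_apply f x))\<^sup>2)"
  unfolding norm_ell2_def by (intro real_sqrt_pow2 infsum_nonneg zero_le_power2)

lemma cinner_self: "cinner f f = complex_of_real ((norm f)\<^sup>2)"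
  unfolding cinner_self_infsum norm_ell2_square ..

lemma ell2_finite_sum_le:
  "finite F \<Longrightarrow> (\<Sum>x\<in>F. (cmod (ell2_apply f x))\<^sup>2) \<le> (norm f)\<^sup>2"
  unfolding norm_ell2_square by (rule finite_sum_le_infsum[OF ell2_summable]) simp_all

lemma ell2_apply_minus: "ell2_apply (f - g) x = ell2_apply f x - ell2_apply g x"
  unfolding minus_ell2_def plus_ell2.rep_eq uminus_ell2.rep_eq by simp

lemma norm_ell2_apply_le: "cmod (ell2_apply f x) \<le> norm f"
proof (rule power2_le_imp_le)
  show "(cmod (ell2_apply f x))\<^sup>2 \<le> (norm f)\<^sup>2" using ell2_finite_sum_le[of "{x}" f] by simp
qed (rule norm_ge_zero)

instance ell2 :: (type) banach
proof
  fix X :: "nat \<Rightarrow> 'a ell2"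
  assume X: "Cauchy X"
  have "Cauchy (\<lambda>n. ell2_apply (X n) x)" for x
    unfolding Cauchy_def
  proof (intro allI impI)
    fix e :: real assume "e > 0"
    then obtain M where "\<forall>m\<ge>M. \<forall>n\<ge>M. norm (X m - X n) < e"
      using X unfolding Cauchy_def dist_norm by blast
    then show "\<exists>M. \<forall>m\<ge>M. \<forall>n\<ge>M. dist (ell2_apply (X m) x) (ell2_apply (X n) x) < e"
      by (metis dist_norm ell2_apply_minus norm_ell2_apply_le le_less_trans)
  qed
  then obtain l where l: "(\<lambda>n. ell2_apply (X n) x) \<longlonglongrightarrow> l x" for x
    unfolding Cauchy_convergent_iff convergent_def by metis
  have bound: "(\<Sum>x\<in>F. (cmod (l x - ell2_apply (X n) x))\<^sup>2) \<le> e\<^sup>2"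
    if M: "\<forall>m\<ge>M. norm (X m - X n) \<le> e" and F: "finite F" for M n e F
  proof (rule LIMSEQ_le_const2)
    show "(\<lambda>m. \<Sum>x\<in>F. (cmod (ell2_apply (X m) x - ell2_apply (X n) x))\<^sup>2)
        \<longlonglongrightarrow> (\<Sum>x\<in>F. (cmod (l x - ell2_apply (X n) x))\<^sup>2)"
      by (intro tendsto_intros l)
    have "(\<Sum>x\<in>F. (cmod (ell2_apply (X m) x - ell2_apply (X n) x))\<^sup>2) \<le> e\<^sup>2" if "m \<ge> M" for m
    proof -
      have "(\<Sum>x\<in>F. (cmod (ell2_apply (X m) x - ell2_apply (X n) x))\<^sup>2) \<le> (norm (X m - X n))\<^sup>2"
        using ell2_finite_sum_le[OF F, of "X m - X n"] by (simp add: ell2_apply_minus)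
      also have "\<dots> \<le> e\<^sup>2" using M that by (intro power_mono) auto
      finally show ?thesis .
    qed
    then show "\<exists>N. \<forall>m\<ge>N. (\<Sum>x\<in>F. (cmod (ell2_apply (X m) x - ell2_apply (X n) x))\<^sup>2) \<le> e\<^sup>2"
      by blast
  qed
  have summ: "(\<lambda>x. (cmod (l x - ell2_apply (X n) x))\<^sup>2) summable_on UNIV"
    if "\<forall>m\<ge>M. norm (X m - X n) \<le> e" for M n e
    using bound[OF that] by (intro nonneg_bdd_above_summable_on) (auto simp: bdd_above_def)
  have CauchyX: "\<exists>M. \<forall>m\<ge>M. \<forall>n\<ge>M. norm (X m - X n) \<le> e" if "e > 0" for e
    using X that unfolding Cauchy_def dist_norm by (meson less_imp_le)
  obtain M where M: "\<forall>m\<ge>M. norm (X m - X M) \<le> 1" using CauchyX[of 1] by auto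
  have "(\<lambda>x. (cmod ((l x - ell2_apply (X M) x) + ell2_apply (X M) x))\<^sup>2) summable_on UNIV"
    by (rule square_summable_add[OF summ[OF M] ell2_summable])
  then have "(\<lambda>x. (cmod (l x))\<^sup>2) summable_on UNIV" by simp
  then have L: "ell2_apply (Abs_ell2 l) = l" by (simp add: Abs_ell2_inverse)
  have "X \<longlonglongrightarrow> Abs_ell2 l"
  proof (rule LIMSEQ_I)
    fix e :: real assume e: "0 < e"
    then obtain N where N: "\<forall>m\<ge>N. \<forall>n\<ge>N. norm (X m - X n) \<le> e / 2" using CauchyX[of "e / 2"] by auto
    have "norm (X n - Abs_ell2 l) < e" if n: "n \<ge> N" for n
    proof -
      have N': "\<forall>m\<ge>N. norm (X m - X n) \<le> e / 2" using N n by blast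
      have "(norm (Abs_ell2 l - X n))\<^sup>2 \<le> (e / 2)\<^sup>2"
        unfolding norm_ell2_square ell2_apply_minus L
        by (intro infsum_le_finite_sums summ[OF N'] bound[OF N'])
      then have "norm (Abs_ell2 l - X n) \<le> e / 2" by (rule power2_le_imp_le) (use e in simp)
      then show ?thesis using e by (simp add: norm_minus_commute)
    qed
    then show "\<exists>no. \<forall>n\<ge>no. norm (X n - Abs_ell2 l) < e" by blast
  qed
  then show "convergent X" unfolding convergent_def by blast
qed

lift_definition delta :: "'a \<Rightarrow> 'a ell2" is "\<lambda>x y. if y = x then 1 else 0"
proof -
  fix x :: 'a
  let ?h = "\<lambda>y. (cmod (if y = x then 1 else 0))\<^sup>2"
  have "?h summable_on {x} \<longleftrightarrow> ?h summable_on UNIV"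
    by (rule summable_on_cong_neutral) simp_all
  then show "?h summable_on UNIV" by simp
qed

lemma square_summable_restrict:
  fixes f :: "'a \<Rightarrow> complex"
  assumes "(\<lambda>x. (cmod (f x))\<^sup>2) summable_on UNIV"
  shows "(\<lambda>x. (cmod (if x \<in> A then f x else 0))\<^sup>2) summable_on UNIV"
  by (rule summable_on_comparison_test[OF assms]) auto

lift_definition restrict_ell2 :: "'a set \<Rightarrow> 'a ell2 \<Rightarrow> 'a ell2"
  is "\<lambda>A f x. if x \<in> A then f x else 0" by (rule square_summable_restrict)


subsection \<open>Operators\<close>

text \<open>Bounded real-linear operators on \<^typ>\<open>'a ell2\<close> are the library type
  \<^typ>\<open>'a ell2 \<Rightarrow>\<^sub>L 'a ell2\<close>, normed by the operator norm; the bounded operators of the complex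
  Hilbert space are the complex-linear ones among them.\<close>

definition bounded_operators :: "('a ell2 \<Rightarrow>\<^sub>L 'a ell2) set" where
  "bounded_operators = {a. \<forall>c f. blinfun_apply a (c *\<^sub>C f) = c *\<^sub>C blinfun_apply a f}"

definition is_adjoint :: "('a ell2 \<Rightarrow>\<^sub>L 'a ell2) \<Rightarrow> ('a ell2 \<Rightarrow>\<^sub>L 'a ell2) \<Rightarrow> bool" where
  "is_adjoint a b \<longleftrightarrow> (\<forall>f g. cinner (blinfun_apply b f) g = cinner f (blinfun_apply a g))"

lift_definition chi :: "'a set \<Rightarrow> ('a ell2 \<Rightarrow>\<^sub>L 'a ell2)" is restrict_ell2
proof
  fix A :: "'a set" and f g :: "'a ell2" and r :: real
  show "restrict_ell2 A (f + g) = restrict_ell2 A f + restrict_ell2 A g" by transfer auto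
  show "restrict_ell2 A (r *\<^sub>R f) = r *\<^sub>R restrict_ell2 A f"
    unfolding scaleR_ell2_def by transfer auto
  have "norm (restrict_ell2 A f) \<le> norm f * 1" for f
    unfolding norm_ell2_def mult_1_right real_sqrt_le_iff
    by (rule infsum_mono[OF ell2_summable ell2_summable]) (simp add: restrict_ell2.rep_eq)
  then show "\<exists>K. \<forall>f. norm (restrict_ell2 A f) \<le> norm f * K" by blast
qed

definition uniformly_locally_finite :: "'a::metric_space itself \<Rightarrow> bool" where
  "uniformly_locally_finite TYPE('a) \<longleftrightarrow>
     (\<forall>r>0. \<exists>N. \<forall>x::'a. finite (cball x r) \<and> card (cball x r) \<le> N)"

text \<open>\<^const>\<open>setdist\<close> is \<open>0\<close> rather than \<open>\<infinity>\<close> when one of the sets is empty; this does not affect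
  the following definition, since then \<open>chi A\<close> or \<open>chi B\<close> is zero.\<close>

definition quasi_local_algebra :: "('a::metric_space ell2 \<Rightarrow>\<^sub>L 'a ell2) set" where
  "quasi_local_algebra =
     {a \<in> bounded_operators. \<forall>\<epsilon>>0. \<exists>r>0. \<forall>A B.
        setdist A B > r \<longrightarrow> norm (chi A o\<^sub>L a o\<^sub>L chi B) \<le> \<epsilon>}"

definition ghost :: "('a ell2 \<Rightarrow>\<^sub>L 'a ell2) \<Rightarrow> bool" where
  "ghost a \<longleftrightarrow> a \<in> bounded_operators \<and>
     (\<forall>\<epsilon>>0. \<exists>F. finite F \<and> (\<forall>x. x \<notin> F \<longrightarrow> norm (blinfun_apply a (delta x)) < \<epsilon>))"


subsection \<open>Products of matrix algebras\<close>

text \<open>An element of \<open>\<Prod>\<^sub>k M\<^bsub>n k\<^esub>(\<complex>)\<close> is a sequence of matrices, the \<open>k\<close>-th one of size \<open>n k\<close>, that is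
  bounded in the C*-norm, i.e. the operator norm with respect to the Euclidean norms; all
  operations are entrywise in \<open>k\<close>.\<close>

definition l2_norm_vec :: "complex Matrix.vec \<Rightarrow> real" where
  "l2_norm_vec v = L2_set (\<lambda>i. cmod (vec_index v i)) {..<dim_vec v}"

definition op_norm_mat :: "complex mat \<Rightarrow> real" where
  "op_norm_mat A = Sup {l2_norm_vec (A *\<^sub>v v) | v. v \<in> carrier_vec (dim_col A) \<and> l2_norm_vec v \<le> 1}"

definition matrix_product :: "(nat \<Rightarrow> nat) \<Rightarrow> (nat \<Rightarrow> complex mat) set" where
  "matrix_product n = {a. (\<forall>k. a k \<in> carrier_mat (n k) (n k)) \<and> bdd_above (range (\<lambda>k. op_norm_mat (a k)))}"

definition matrix_c0_sum :: "(nat \<Rightarrow> nat) \<Rightarrow> (nat \<Rightarrow> complex mat) set" where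
  "matrix_c0_sum n = {a \<in> matrix_product n. (\<lambda>k. op_norm_mat (a k)) \<longlonglongrightarrow> 0}"

text \<open>Only the values of \<open>\<Phi>\<close> on \<open>matrix_product n\<close> matter; no unitality or normality is required.\<close>

definition star_homomorphism ::
    "(nat \<Rightarrow> nat) \<Rightarrow> ((nat \<Rightarrow> complex mat) \<Rightarrow> ('a ell2 \<Rightarrow>\<^sub>L 'a ell2)) \<Rightarrow> bool" where
  "star_homomorphism n \<Phi> \<longleftrightarrow>
     (\<forall>a\<in>matrix_product n. \<forall>b\<in>matrix_product n. \<Phi> (\<lambda>k. a k + b k) = \<Phi> a + \<Phi> b) \<and>
     (\<forall>c. \<forall>a\<in>matrix_product n. \<forall>f.
        blinfun_apply (\<Phi> (\<lambda>k. c \<cdot>\<^sub>m a k)) f = c *\<^sub>C blinfun_apply (\<Phi> a) f) \<and>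
     (\<forall>a\<in>matrix_product n. \<forall>b\<in>matrix_product n. \<Phi> (\<lambda>k. a k * b k) = \<Phi> a o\<^sub>L \<Phi> b) \<and>
     (\<forall>a\<in>matrix_product n. is_adjoint (\<Phi> a) (\<Phi> (\<lambda>k. mat_adjoint (a k))))"

end

theory Submission
  imports Defs "HOL-Library.Discrete_Functions"
begin

text \<open>Since \<open>\<Phi> a = \<Phi> a \<circ> \<Phi> 1\<close>, it is enough that the projection \<open>\<Phi> 1\<close> is a ghost. If \<open>u\<close>, \<open>v\<close>
  satisfy \<open>u* v = - v* u\<close>, then \<open>\<Phi> u \<xi>\<close> and \<open>\<Phi> v \<xi>\<close> are orthogonal for the real inner product, for
  every vector \<open>\<xi>\<close>, and large matrix algebras contain many unitaries related in this way. This is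
  used twice. A nonzero vector fixed by all \<open>\<Phi> (1\<^bsub>[K,\<infinity>)\<^esub>)\<close> would yield an uncountable orthogonal family in the
  separable space \<open>\<ell>\<^sub>2(X)\<close>; hence \<open>\<Phi> (1\<^bsub>[K,\<infinity>)\<^esub>)\<close> tends strongly to \<open>0\<close>. If \<open>\<Phi> 1\<close> is not a ghost,
  there are therefore points \<open>x\<^sub>j\<close> and disjoint finite blocks \<open>I\<^sub>j\<close> such that \<open>\<Phi> 1 \<delta>\<^bsub>x\<^sub>j\<^esub>\<close> has norm bounded
  below and is carried by \<open>\<Phi> (1\<^bsub>I\<^sub>j\<^esub>)\<close> up to a small error. By Bessel's inequality one of many
  anticommuting unitaries on the block moves at least half of this vector out of the ball of radius
  \<open>j + 1\<close> about \<open>x\<^sub>j\<close>, because the number of points in that ball is bounded in advance. Gluing these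
  unitaries gives one element of the product whose image is not quasi-local.\<close>

subsection \<open>Orthogonal families\<close>

text \<open>Cauchy-Schwarz for \<open>e\<close> against \<open>p\<close>, the combination of the
  \<open>w i\<close> with their own coefficients: \<open>inner p e\<close> is the sum itself and
  \<open>inner p p\<close> is \<open>c\<close> times it, so one factor cancels. A common squared
  norm \<open>c\<close> replaces normalisation and includes \<open>c = 0\<close>.\<close>

lemma bessel_real:
  fixes w :: "'i \<Rightarrow> 'v::real_inner"
  assumes "finite F" and orth: "\<And>i j. i \<in> F \<Longrightarrow> j \<in> F \<Longrightarrow> i \<noteq> j \<Longrightarrow> inner (w i) (w j) = 0"
    and c: "\<And>i. i \<in> F \<Longrightarrow> (norm (w i))\<^sup>2 = c" and "0 \<le> c"
  shows "(\<Sum>i\<in>F. (inner (w i) e)\<^sup>2) \<le> c * (norm e)\<^sup>2"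
proof -
  define t where "t i = inner (w i) e" for i
  define p where "p = (\<Sum>i\<in>F. t i *\<^sub>R w i)"
  let ?s = "\<Sum>i\<in>F. (t i)\<^sup>2"
  have pe: "inner p e = ?s"
    by (simp add: p_def inner_sum_left power2_eq_square t_def)
  have "inner p p = (\<Sum>i\<in>F. \<Sum>j\<in>F. t i * (t j * inner (w i) (w j)))"
    by (simp add: p_def inner_sum_left inner_sum_right sum_distrib_left algebra_simps)
      (intro sum.cong refl, simp add: inner_commute)
  also have "\<dots> = (\<Sum>i\<in>F. \<Sum>j\<in>F. if i = j then c * (t i)\<^sup>2 else 0)"
    using c by (intro sum.cong refl) (auto simp: orth power2_eq_square norm_eq_sqrt_inner algebra_simps)
  also have "\<dots> = c * ?s" using \<open>finite F\<close> by (simp add: sum_distrib_left)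
  finally have pp: "inner p p = c * ?s" .
  have s0: "0 \<le> ?s" by (simp add: sum_nonneg)
  have "?s\<^sup>2 \<le> c * ?s * (norm e)\<^sup>2"
    using Cauchy_Schwarz_ineq[of p e] by (simp add: pe pp power2_norm_eq_inner)
  then have "?s * ?s \<le> c * (norm e)\<^sup>2 * ?s" by (simp add: power2_eq_square algebra_simps)
  then have "?s \<le> c * (norm e)\<^sup>2"
    using s0 \<open>0 \<le> c\<close> by (cases "?s = 0") (simp_all)
  then show ?thesis by (simp add: t_def)
qed

text \<open>Bessel bounds all finite partial sums, and a summable real family has countable
  support.\<close>

lemma countable_orthogonal_coordinates:
  fixes w :: "'i \<Rightarrow> 'v::real_inner"
  assumes orth: "\<And>i j. i \<in> S \<Longrightarrow> j \<in> S \<Longrightarrow> i \<noteq> j \<Longrightarrow> inner (w i) (w j) = 0"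
    and c: "\<And>i. i \<in> S \<Longrightarrow> (norm (w i))\<^sup>2 = c" and "0 \<le> c"
  shows "countable {i \<in> S. inner (w i) e \<noteq> 0}"
proof -
  have "(\<Sum>i\<in>F. (inner (w i) e)\<^sup>2) \<le> c * (norm e)\<^sup>2" if "finite F" "F \<subseteq> S" for F
    using that \<open>0 \<le> c\<close> by (intro bessel_real) (auto intro!: orth c)
  then have "(\<lambda>i. (inner (w i) e)\<^sup>2) summable_on S"
    by (intro nonneg_bdd_above_summable_on bdd_aboveI2) auto
  from summable_countable_real[OF this] show ?thesis by simp
qed

lemma inner_delta: "inner f (delta y) = Re (ell2_apply f y)"
proof -
  have "cinner f (delta y) = (\<Sum>\<^sub>\<infinity>x\<in>{y}. ell2_apply f x * cnj (ell2_apply (delta y) x))"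
    unfolding cinner_def by (rule infsum_cong_neutral) (auto simp: delta.rep_eq)
  then show ?thesis by (simp add: inner_ell2_def delta.rep_eq)
qed

text \<open>The real inner product with \<open>delta y\<close> sees only the real part of a
  coordinate; \<open>\<i> *\<^sub>C delta y\<close> recovers the imaginary part. Each point thus
  counts as two real directions.\<close>

lemma inner_ii_delta: "inner f (\<i> *\<^sub>C delta y) = Im (ell2_apply f y)"
proof -
  have "cinner f (\<i> *\<^sub>C delta y) = (\<Sum>\<^sub>\<infinity>x\<in>{y}. ell2_apply f x * cnj (ell2_apply (\<i> *\<^sub>C delta y) x))"
    unfolding cinner_def by (rule infsum_cong_neutral) (auto simp: delta.rep_eq scaleC.rep_eq)
  then show ?thesis by (simp add: inner_ell2_def delta.rep_eq scaleC.rep_eq)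
qed

lemma norm_delta [simp]: "norm (delta y) = 1"
  using inner_delta[of "delta y" y] by (simp add: delta.rep_eq norm_eq_sqrt_inner)

lemma norm_ii_delta [simp]: "norm (\<i> *\<^sub>C delta y) = 1"
  using inner_ii_delta[of "\<i> *\<^sub>C delta y" y] by (simp add: delta.rep_eq norm_eq_sqrt_inner scaleC.rep_eq)

text \<open>If \<open>c\<close> were nonzero, every member would have a nonzero coefficient in one
  of countably many real directions, while each direction is met by only countably many
  members.\<close>

lemma no_uncountable_orthogonal_family:
  fixes w :: "'i \<Rightarrow> 'x ell2"
  assumes "countable (UNIV :: 'x set)" and "uncountable S"
    and orth: "\<And>i j. i \<in> S \<Longrightarrow> j \<in> S \<Longrightarrow> i \<noteq> j \<Longrightarrow> inner (w i) (w j) = 0"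
    and c: "\<And>i. i \<in> S \<Longrightarrow> (norm (w i))\<^sup>2 = c"
  shows "c = 0"
proof (rule ccontr)
  assume "c \<noteq> 0"
  obtain i0 where "i0 \<in> S" using \<open>uncountable S\<close> by (metis countable_empty ex_in_conv)
  then have "0 \<le> c" using c by (metis zero_le_power2)
  note cnt = countable_orthogonal_coordinates[of S w c, OF orth c \<open>0 \<le> c\<close>]
  have "i \<in> (\<Union>y. {i \<in> S. inner (w i) (delta y) \<noteq> 0} \<union> {i \<in> S. inner (w i) (\<i> *\<^sub>C delta y) \<noteq> 0})"
    if "i \<in> S" for i
  proof -
    have "w i \<noteq> 0" using c[OF that] \<open>c \<noteq> 0\<close> by auto
    then obtain y where "ell2_apply (w i) y \<noteq> 0"
      by (metis ell2_apply_inject ext zero_ell2.rep_eq)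
    then show ?thesis using that by (auto simp: inner_delta inner_ii_delta complex_eq_iff)
  qed
  then have "S \<subseteq> (\<Union>y. {i \<in> S. inner (w i) (delta y) \<noteq> 0} \<union> {i \<in> S. inner (w i) (\<i> *\<^sub>C delta y) \<noteq> 0})"
    by blast
  moreover have "countable \<dots>"
    using assms(1) by (intro countable_UN countable_Un cnt) auto
  ultimately show False using \<open>uncountable S\<close> countable_subset by blast
qed

section \<open>Truncation to sets of points\<close>

lemma chi_apply: "blinfun_apply (chi A) f = restrict_ell2 A f"
  by (simp add: chi.rep_eq)

lemma norm_chi_finite:
  assumes "finite B"
  shows "(norm (chi B f))\<^sup>2 = (\<Sum>y\<in>B. (cmod (ell2_apply f y))\<^sup>2)"
proof -
  have "(norm (chi B f))\<^sup>2 = (\<Sum>\<^sub>\<infinity>y\<in>B. (cmod (ell2_apply f y))\<^sup>2)"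
    unfolding norm_ell2_square chi_apply
    by (rule infsum_cong_neutral) (auto simp: restrict_ell2.rep_eq)
  then show ?thesis using assms by simp
qed

lemma chi_Compl: "chi B f + chi (- B) f = f"
  unfolding chi_apply by transfer auto

lemma norm_chi_le: "norm (chi A f) \<le> norm f"
  unfolding norm_ell2_def chi_apply real_sqrt_le_iff
  by (rule infsum_mono[OF ell2_summable ell2_summable]) (simp add: restrict_ell2.rep_eq)

text \<open>Otherwise the truncations to \<open>B\<close> have total squared norm above
  \<open>M * (c / 2)\<^sup>2\<close>, whereas Bessel in the two real directions at each point of
  \<open>B\<close> allows at most \<open>2 * card B * c\<^sup>2\<close>. This is where the factor 8
  comes from.\<close>

lemma ex_small_on_finite_set:
  fixes w :: "nat \<Rightarrow> 'x ell2"
  assumes "finite B" "8 * card B \<le> M" "0 < M"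
    and orth: "\<And>i j. i < M \<Longrightarrow> j < M \<Longrightarrow> i \<noteq> j \<Longrightarrow> inner (w i) (w j) = 0"
    and c: "\<And>i. i < M \<Longrightarrow> norm (w i) = c"
  obtains i where "i < M" "norm (chi B (w i)) \<le> norm (w i) / 2"
proof (rule ccontr)
  note found = that
  assume "\<not> thesis"
  then have *: "c / 2 < norm (chi B (w i))" if "i < M" for i
    using found[OF that] c[OF that] by force
  have "0 \<le> c" using c[OF \<open>0 < M\<close>] by (metis norm_ge_zero)
  have b: "(\<Sum>i<M. (inner (w i) e)\<^sup>2) \<le> c\<^sup>2 * (norm e)\<^sup>2" for e
    by (rule bessel_real) (auto simp: orth c)
  have "real M * (c / 2)\<^sup>2 = (\<Sum>i<M. (c / 2)\<^sup>2)" by simp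
  also have "\<dots> < (\<Sum>i<M. (norm (chi B (w i)))\<^sup>2)"
    using * \<open>0 \<le> c\<close> \<open>0 < M\<close> by (intro sum_strict_mono power_strict_mono) auto
  also have "\<dots> = (\<Sum>y\<in>B. \<Sum>i<M. (inner (w i) (delta y))\<^sup>2 + (inner (w i) (\<i> *\<^sub>C delta y))\<^sup>2)"
    unfolding norm_chi_finite[OF \<open>finite B\<close>] inner_delta inner_ii_delta cmod_power2
    by (rule sum.swap)
  also have "\<dots> \<le> (\<Sum>y\<in>B. 2 * c\<^sup>2)"
  proof (rule sum_mono)
    fix y
    show "(\<Sum>i<M. (inner (w i) (delta y))\<^sup>2 + (inner (w i) (\<i> *\<^sub>C delta y))\<^sup>2) \<le> 2 * c\<^sup>2"
      using b[of "delta y"] b[of "\<i> *\<^sub>C delta y"] by (simp add: sum.distrib)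
  qed
  also have "\<dots> = 8 * real (card B) * (c / 2)\<^sup>2" by (simp add: power2_eq_square)
  also have "\<dots> \<le> real M * (c / 2)\<^sup>2"
  proof (rule mult_right_mono)
    show "8 * real (card B) \<le> real M" using assms(2) by linarith
  qed simp
  finally show False by simp
qed

subsection \<open>Contractive matrices\<close>

lemma square_mat_eqI:
  assumes "A \<in> carrier_mat n n" "B \<in> carrier_mat n n"
    and "\<And>s t. s < n \<Longrightarrow> t < n \<Longrightarrow> A $$ (s, t) = B $$ (s, t)"
  shows "A = B"
  using assms by (intro eq_matI) auto

lemma mat_adjoint_carrier: "A \<in> carrier_mat n n \<Longrightarrow> mat_adjoint A \<in> carrier_mat n n"
  unfolding mat_adjoint_def by auto

lemma mat_adjoint_index:
  assumes "A \<in> carrier_mat n n" "r < n" "s < n"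
  shows "mat_adjoint A $$ (r, s) = cnj (A $$ (s, r))"
  using assms unfolding mat_adjoint_def by (simp add: mat_of_rows_index cols_def)

lemma mat_mult_index:
  assumes "A \<in> carrier_mat n n" "B \<in> carrier_mat n n" "r < n" "s < n"
  shows "(A * B) $$ (r, s) = (\<Sum>j<n. A $$ (r, j) * B $$ (j, s))"
  using assms by (simp add: scalar_prod_def atLeast0LessThan)

text \<open>A vectorwise bound avoids the supremum in \<open>op_norm_mat\<close> and passes to
  products at once.\<close>

definition contraction_mat :: "nat \<Rightarrow> complex mat \<Rightarrow> bool" where
  "contraction_mat n A \<longleftrightarrow> A \<in> carrier_mat n n \<and> (\<forall>v\<in>carrier_vec n. l2_norm_vec (A *\<^sub>v v) \<le> l2_norm_vec v)"

lemma contraction_mat_op_norm: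
  assumes "contraction_mat n A"
  shows "op_norm_mat A \<le> 1"
  unfolding op_norm_mat_def
proof (rule cSup_least)
  have "0\<^sub>v (dim_col A) \<in> carrier_vec (dim_col A) \<and> l2_norm_vec (0\<^sub>v (dim_col A)) \<le> 1"
    by (simp add: l2_norm_vec_def L2_set_def)
  then show "{l2_norm_vec (A *\<^sub>v v) |v. v \<in> carrier_vec (dim_col A) \<and> l2_norm_vec v \<le> 1} \<noteq> {}"
    by blast
qed (use assms in \<open>auto simp: contraction_mat_def intro: order_trans\<close>)

lemma contraction_mat_mult:
  assumes "contraction_mat n A" "contraction_mat n B"
  shows "contraction_mat n (A * B)"
  unfolding contraction_mat_def
proof (intro conjI ballI)
  have AB: "A \<in> carrier_mat n n" "B \<in> carrier_mat n n" using assms by (auto simp: contraction_mat_def)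
  then show "A * B \<in> carrier_mat n n" by simp
  fix v :: "complex Matrix.vec" assume v: "v \<in> carrier_vec n"
  have "l2_norm_vec (A *\<^sub>v (B *\<^sub>v v)) \<le> l2_norm_vec (B *\<^sub>v v)"
    using assms(1) AB v by (simp add: contraction_mat_def)
  also have "\<dots> \<le> l2_norm_vec v" using assms(2) v by (simp add: contraction_mat_def)
  finally show "l2_norm_vec (A * B *\<^sub>v v) \<le> l2_norm_vec v"
    using AB v by simp
qed

text \<open>At most one nonzero entry in each row and column: a shape stable under adjoints and
  shared by the zero, identity, Clifford and column projection matrices.\<close>

definition monomial_contraction :: "nat \<Rightarrow> complex mat \<Rightarrow> bool" where
  "monomial_contraction n A \<longleftrightarrow> A \<in> carrier_mat n n \<and>
     (\<forall>r<n. \<forall>s<n. cmod (A $$ (r, s)) \<le> 1) \<and>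
     (\<forall>r<n. \<forall>s<n. \<forall>s'<n. A $$ (r, s) \<noteq> 0 \<and> A $$ (r, s') \<noteq> 0 \<longrightarrow> s = s') \<and>
     (\<forall>s<n. \<forall>r<n. \<forall>r'<n. A $$ (r, s) \<noteq> 0 \<and> A $$ (r', s) \<noteq> 0 \<longrightarrow> r = r')"

lemma monomial_contraction_adjoint:
  "monomial_contraction n A \<Longrightarrow> monomial_contraction n (mat_adjoint A)"
  unfolding monomial_contraction_def by (auto simp: mat_adjoint_carrier mat_adjoint_index[of A n])

lemma cmod_sum_single:
  fixes f :: "nat \<Rightarrow> complex"
  assumes "\<And>s s'. s < n \<Longrightarrow> s' < n \<Longrightarrow> f s \<noteq> 0 \<Longrightarrow> f s' \<noteq> 0 \<Longrightarrow> s = s'"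
  shows "(cmod (\<Sum>s<n. f s))\<^sup>2 = (\<Sum>s<n. (cmod (f s))\<^sup>2)"
proof (cases "\<exists>s<n. f s \<noteq> 0")
  case True
  then obtain s0 where "s0 < n" "f s0 \<noteq> 0" by blast
  then have "f s = 0" if "s < n" "s \<noteq> s0" for s using assms that by blast
  then have "(\<Sum>s<n. f s) = (\<Sum>s\<in>{s0}. f s)" "(\<Sum>s<n. (cmod (f s))\<^sup>2) = (\<Sum>s\<in>{s0}. (cmod (f s))\<^sup>2)"
    using \<open>s0 < n\<close> by (intro sum.mono_neutral_right; auto)+
  then show ?thesis by simp
qed simp

text \<open>The row condition removes all cross terms from the squared coordinates of the image;
  after exchanging the sums, the column condition gives each coordinate of \<open>v\<close> weight
  at most 1.\<close>

lemma monomial_contraction_imp_contraction: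
  assumes A: "monomial_contraction n A"
  shows "contraction_mat n A"
  unfolding contraction_mat_def
proof (intro conjI ballI)
  show car: "A \<in> carrier_mat n n" using A by (simp add: monomial_contraction_def)
  fix v :: "complex Matrix.vec" assume v: "v \<in> carrier_vec n"
  have col: "(\<Sum>r<n. (cmod (A $$ (r, s)))\<^sup>2) \<le> 1" if "s < n" for s
  proof (cases "\<exists>r<n. A $$ (r, s) \<noteq> 0")
    case True
    then obtain r where r: "r < n" "A $$ (r, s) \<noteq> 0" by blast
    have "(\<Sum>r<n. (cmod (A $$ (r, s)))\<^sup>2) = (\<Sum>r\<in>{r}. (cmod (A $$ (r, s)))\<^sup>2)"
      using A r that by (intro sum.mono_neutral_right) (auto simp: monomial_contraction_def)
    then show ?thesis using A r that by (auto simp: monomial_contraction_def power_le_one)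
  qed simp
  have "(\<Sum>r<n. (cmod (vec_index (A *\<^sub>v v) r))\<^sup>2) = (\<Sum>r<n. (cmod (\<Sum>s<n. A $$ (r, s) * vec_index v s))\<^sup>2)"
    using car v by (simp add: scalar_prod_def atLeast0LessThan)
  also have "\<dots> = (\<Sum>r<n. \<Sum>s<n. (cmod (A $$ (r, s) * vec_index v s))\<^sup>2)"
    using A by (intro sum.cong refl cmod_sum_single) (auto simp: monomial_contraction_def)
  also have "\<dots> = (\<Sum>s<n. (\<Sum>r<n. (cmod (A $$ (r, s)))\<^sup>2) * (cmod (vec_index v s))\<^sup>2)"
    by (subst sum.swap) (simp add: norm_mult power_mult_distrib sum_distrib_right)
  also have "\<dots> \<le> (\<Sum>s<n. 1 * (cmod (vec_index v s))\<^sup>2)"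
    using col by (intro sum_mono mult_right_mono) auto
  finally show "l2_norm_vec (A *\<^sub>v v) \<le> l2_norm_vec v"
    using car v by (simp add: l2_norm_vec_def L2_set_def)
qed

lemma contraction_mat_zero [simp]: "contraction_mat n (0\<^sub>m n n)"
  by (rule monomial_contraction_imp_contraction) (simp add: monomial_contraction_def)

lemma contraction_mat_one [simp]: "contraction_mat n (1\<^sub>m n)"
  by (rule monomial_contraction_imp_contraction) (auto simp: monomial_contraction_def split: if_splits)

lemma mat_adjoint_one [simp]: "mat_adjoint (1\<^sub>m n :: complex mat) = 1\<^sub>m n"
  by (rule square_mat_eqI[of _ n]) (auto simp: mat_adjoint_carrier mat_adjoint_index[of _ n])

lemma mat_adjoint_zero [simp]: "mat_adjoint (0\<^sub>m n n :: complex mat) = 0\<^sub>m n n"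
  by (rule square_mat_eqI[of _ n]) (auto simp: mat_adjoint_carrier mat_adjoint_index[of _ n])

subsection \<open>Anticommuting partial isometries\<close>

text \<open>The Jordan--Wigner signs make flips of different bits anticommute.\<close>

definition jw_sign :: "nat \<Rightarrow> nat \<Rightarrow> complex" where
  "jw_sign i s = (\<Prod>j<i. if bit s j then - 1 else 1)"

lemma jw_sign_norm [simp]: "cmod (jw_sign i s) = 1"
  by (simp add: jw_sign_def flip: prod_norm)

lemma jw_sign_cnj [simp]: "cnj (jw_sign i s) = jw_sign i s"
  unfolding jw_sign_def cnj_prod by (rule prod.cong) auto

lemma jw_sign_square [simp]: "jw_sign i s * jw_sign i s = 1"
  by (simp add: jw_sign_def flip: prod.distrib)

lemma jw_sign_flip_high: "i \<le> j \<Longrightarrow> jw_sign i (flip_bit j s) = jw_sign i s"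
  by (simp add: jw_sign_def bit_flip_bit_iff)

lemma jw_sign_flip_low:
  assumes "i < j"
  shows "jw_sign j (flip_bit i s) = - jw_sign j s"
proof -
  have "jw_sign j t = (if bit t i then - 1 else 1) * (\<Prod>k\<in>{..<j}-{i}. if bit t k then - 1 else 1)" for t
    unfolding jw_sign_def using assms by (intro prod.remove) auto
  moreover have "(\<Prod>k\<in>{..<j}-{i}. if bit (flip_bit i s) k then - 1 else 1 :: complex) =
      (\<Prod>k\<in>{..<j}-{i}. if bit s k then - 1 else 1)"
    by (intro prod.cong) (auto simp: bit_flip_bit_iff)
  ultimately show ?thesis by (simp add: bit_flip_bit_iff)
qed

lemma flip_bit_flip_bit [simp]: "flip_bit i (flip_bit i s) = (s :: nat)"
  by (rule bit_eqI) (auto simp: bit_flip_bit_iff)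

lemma flip_bit_commute: "flip_bit i (flip_bit j s) = flip_bit j (flip_bit i (s :: nat))"
  by (rule bit_eqI) (auto simp: bit_flip_bit_iff)

lemma flip_bit_inject [simp]: "flip_bit i s = flip_bit i t \<longleftrightarrow> s = (t :: nat)"
  by (metis flip_bit_flip_bit)

lemma flip_bit_less: "i < m \<Longrightarrow> s < 2 ^ m \<Longrightarrow> flip_bit i s < (2 ^ m :: nat)"
  by (metis linorder_not_le take_bit_flip_bit_eq take_bit_nat_eq_self_iff)

text \<open>Here \<open>t\<close> arises from \<open>s\<close> by flipping both bits. The sign with
  the larger index notices the lower flip and changes; the other sign does not.\<close>

lemma jw_sign_anticommute:
  assumes "i \<noteq> j" "flip_bit i s = flip_bit j t"
  shows "jw_sign i s * jw_sign j t = - (jw_sign j s * jw_sign i t)"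
proof -
  have t: "t = flip_bit j (flip_bit i s)" using assms(2) by simp
  show ?thesis
  proof (cases "i < j")
    case True
    then show ?thesis by (simp add: t jw_sign_flip_low jw_sign_flip_high)
  next
    case False
    then have "j < i" using assms(1) by simp
    then show ?thesis
      by (simp add: t flip_bit_commute[of j i] jw_sign_flip_low jw_sign_flip_high)
  qed
qed

text \<open>With \<open>m = floor_log n\<close>, so that \<open>2 ^ m \<le> n < 2 * 2 ^ m\<close>, the matrices for \<open>b = False\<close> live on
  the columns below \<open>2 ^ m\<close>, those for \<open>b = True\<close> on the remaining ones. Two families are needed
  because anticommuting unitaries exist only in even dimensions.\<close>

definition clifford_col :: "nat \<Rightarrow> bool \<Rightarrow> nat \<Rightarrow> bool" where
  "clifford_col n b s \<longleftrightarrow> (b \<longleftrightarrow> 2 ^ floor_log n \<le> s)"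

definition clifford_off :: "nat \<Rightarrow> bool \<Rightarrow> nat \<Rightarrow> nat" where
  "clifford_off n b s = (if b then s - 2 ^ floor_log n else s)"

text \<open>A signed partial isometry whose initial space depends on \<open>b\<close> but not on
  \<open>i\<close>, as long as \<open>i < floor_log n\<close>. Only products of an adjoint with a
  matrix of the same family occur, so both families may map into the first
  \<open>2 ^ floor_log n\<close> coordinates. Larger \<open>i\<close> give zero, so that every index
  yields a contraction.\<close>

definition clifford :: "nat \<Rightarrow> bool \<Rightarrow> nat \<Rightarrow> complex mat" where
  "clifford n b i = mat n n (\<lambda>(r, s). if i < floor_log n \<and> clifford_col n b s \<and> r = flip_bit i (clifford_off n b s)
     then jw_sign i (clifford_off n b s) else 0)"

definition col_proj :: "nat \<Rightarrow> bool \<Rightarrow> complex mat" where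
  "col_proj n b = mat n n (\<lambda>(r, s). if r = s \<and> clifford_col n b s then 1 else 0)"

lemma clifford_off_inject:
  "clifford_col n b s \<Longrightarrow> clifford_col n b t \<Longrightarrow> clifford_off n b s = clifford_off n b t \<longleftrightarrow> s = t"
  by (auto simp: clifford_off_def clifford_col_def)

lemma clifford_carrier [simp]: "clifford n b i \<in> carrier_mat n n"
  by (simp add: clifford_def)

lemma clifford_eq_zero: "\<not> i < floor_log n \<Longrightarrow> clifford n b i = 0\<^sub>m n n"
  by (rule square_mat_eqI[OF clifford_carrier zero_carrier_mat]) (simp add: clifford_def)

lemma col_proj_carrier [simp]: "col_proj n b \<in> carrier_mat n n"
  by (simp add: col_proj_def)

lemma clifford_flip_less:
  assumes "i < floor_log n" "s < n" "clifford_col n b s"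
  shows "flip_bit i (clifford_off n b s) < n"
proof -
  have "n > 0" using assms(2) by simp
  \<comment> \<open>For the second family this is the bound
    \<open>n < 2 * 2 ^ floor_log n\<close>.\<close>
  have "clifford_off n b s < 2 ^ floor_log n"
    using floor_log_exp2_gt[of n] assms by (auto simp: clifford_off_def clifford_col_def)
  from flip_bit_less[OF assms(1) this] show ?thesis
    using floor_log_exp2_le[OF \<open>n > 0\<close>] by linarith
qed

lemma clifford_monomial: "monomial_contraction n (clifford n b i)"
  unfolding monomial_contraction_def clifford_def
  by (auto simp: clifford_off_inject split: if_splits)

lemma col_proj_monomial: "monomial_contraction n (col_proj n b)"
  unfolding monomial_contraction_def col_proj_def by (auto split: if_splits)

lemma contraction_clifford [simp]:
  "contraction_mat n (clifford n b i)" "contraction_mat n (mat_adjoint (clifford n b i))"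
  using clifford_monomial monomial_contraction_adjoint monomial_contraction_imp_contraction by blast+

lemma contraction_col_proj [simp]: "contraction_mat n (col_proj n b)"
  using col_proj_monomial monomial_contraction_imp_contraction by blast

text \<open>Each column has at most one nonzero entry, so the inner sum reduces to the single row
  that both columns may hit.\<close>

lemma adjoint_clifford_mult_index:
  assumes "s < n" "t < n"
  shows "(mat_adjoint (clifford n b i) * clifford n b j) $$ (s, t) =
    (if i < floor_log n \<and> j < floor_log n \<and> clifford_col n b s \<and> clifford_col n b t \<and>
        flip_bit i (clifford_off n b s) = flip_bit j (clifford_off n b t)
     then jw_sign i (clifford_off n b s) * jw_sign j (clifford_off n b t) else 0)"
proof -
  have "(mat_adjoint (clifford n b i) * clifford n b j) $$ (s, t) =
      (\<Sum>r<n. cnj (clifford n b i $$ (r, s)) * clifford n b j $$ (r, t))"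
    using assms by (subst mat_mult_index[of _ n])
      (simp_all add: mat_adjoint_carrier mat_adjoint_index[of _ n])
  also have "\<dots> = (\<Sum>r<n. if r = flip_bit i (clifford_off n b s) then
      (if i < floor_log n \<and> j < floor_log n \<and> clifford_col n b s \<and> clifford_col n b t \<and>
        flip_bit i (clifford_off n b s) = flip_bit j (clifford_off n b t)
     then jw_sign i (clifford_off n b s) * jw_sign j (clifford_off n b t) else 0) else 0)"
    using assms by (intro sum.cong refl) (auto simp: clifford_def)
  also have "\<dots> = (if i < floor_log n \<and> j < floor_log n \<and> clifford_col n b s \<and> clifford_col n b t \<and>
        flip_bit i (clifford_off n b s) = flip_bit j (clifford_off n b t)
     then jw_sign i (clifford_off n b s) * jw_sign j (clifford_off n b t) else 0)"
    using clifford_flip_less assms by (auto simp: sum.delta)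
  finally show ?thesis .
qed

lemma adjoint_clifford_mult_carrier:
  "mat_adjoint (clifford n b i) * clifford n b j \<in> carrier_mat n n"
  by (rule mult_carrier_mat[OF mat_adjoint_carrier]) (rule clifford_carrier)+

lemma adjoint_clifford_mult_self:
  assumes "i < floor_log n"
  shows "mat_adjoint (clifford n b i) * clifford n b i = col_proj n b"
proof (rule square_mat_eqI[OF adjoint_clifford_mult_carrier col_proj_carrier])
  fix s t assume "s < n" "t < n"
  then show "(mat_adjoint (clifford n b i) * clifford n b i) $$ (s, t) = col_proj n b $$ (s, t)"
    using assms by (auto simp: adjoint_clifford_mult_index col_proj_def clifford_off_inject
        simp del: index_mult_mat)
qed

text \<open>Flips commute and are involutions, so both products have the same support; on it the
  Jordan--Wigner signs are opposite.\<close>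

lemma adjoint_clifford_anticommute:
  assumes "i \<noteq> j"
  shows "mat_adjoint (clifford n b i) * clifford n b j = (- 1) \<cdot>\<^sub>m (mat_adjoint (clifford n b j) * clifford n b i)"
proof (rule square_mat_eqI[OF adjoint_clifford_mult_carrier smult_carrier_mat[OF adjoint_clifford_mult_carrier]])
  fix s t assume st: "s < n" "t < n"
  let ?s = "clifford_off n b s" and ?t = "clifford_off n b t"
  have flip: "flip_bit i ?s = flip_bit j ?t \<longleftrightarrow> flip_bit j ?s = flip_bit i ?t"
    by (metis flip_bit_commute flip_bit_flip_bit)
  have "((- 1) \<cdot>\<^sub>m (mat_adjoint (clifford n b j) * clifford n b i)) $$ (s, t) =
      - ((mat_adjoint (clifford n b j) * clifford n b i) $$ (s, t))"
    using st carrier_matD[OF adjoint_clifford_mult_carrier, of n b j i]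
    by (subst index_smult_mat) simp_all
  also have "\<dots> = (mat_adjoint (clifford n b i) * clifford n b j) $$ (s, t)"
  proof (cases "flip_bit i ?s = flip_bit j ?t")
    case True
    show ?thesis
      unfolding adjoint_clifford_mult_index[OF st]
      using jw_sign_anticommute[OF assms True] True flip[THEN iffD1, OF True] by simp
  next
    case False
    then have "flip_bit j ?s \<noteq> flip_bit i ?t" using flip by blast
    with False show ?thesis unfolding adjoint_clifford_mult_index[OF st] by simp
  qed
  finally show "(mat_adjoint (clifford n b i) * clifford n b j) $$ (s, t) =
      ((- 1) \<cdot>\<^sub>m (mat_adjoint (clifford n b j) * clifford n b i)) $$ (s, t)" ..
qed

lemma adjoint_col_proj [simp]: "mat_adjoint (col_proj n b) = col_proj n b"
  by (rule square_mat_eqI[OF mat_adjoint_carrier[OF col_proj_carrier] col_proj_carrier])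
    (auto simp: mat_adjoint_index[OF col_proj_carrier], auto simp: col_proj_def)

lemma col_proj_idem [simp]: "col_proj n b * col_proj n b = col_proj n b"
proof (rule square_mat_eqI[OF mult_carrier_mat[OF col_proj_carrier col_proj_carrier] col_proj_carrier])
  fix s t assume st: "s < n" "t < n"
  have "(col_proj n b * col_proj n b) $$ (s, t) = (\<Sum>r<n. col_proj n b $$ (s, r) * col_proj n b $$ (r, t))"
    by (rule mat_mult_index[OF col_proj_carrier col_proj_carrier st])
  also have "\<dots> = (\<Sum>r<n. if r = s then (if s = t \<and> clifford_col n b s then 1 else 0) else 0)"
    using st by (intro sum.cong refl) (auto simp: col_proj_def)
  also have "\<dots> = col_proj n b $$ (s, t)" using st by (auto simp: col_proj_def)
  finally show "(col_proj n b * col_proj n b) $$ (s, t) = col_proj n b $$ (s, t)" .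
qed

lemma col_proj_add: "col_proj n b + col_proj n (\<not> b) = 1\<^sub>m n"
  by (rule eq_matI) (auto simp: col_proj_def clifford_col_def)

subsection \<open>Homomorphisms of matrix products\<close>

lemma scaleC_minus_one: "(- 1) *\<^sub>C f = - f"
  by transfer simp

definition contractive :: "(nat \<Rightarrow> nat) \<Rightarrow> (nat \<Rightarrow> complex mat) \<Rightarrow> bool" where
  "contractive n a \<longleftrightarrow> (\<forall>k. contraction_mat (n k) (a k))"

definition restr :: "(nat \<Rightarrow> nat) \<Rightarrow> nat set \<Rightarrow> (nat \<Rightarrow> complex mat) \<Rightarrow> nat \<Rightarrow> complex mat" where
  "restr n I a = (\<lambda>k. if k \<in> I then a k else 0\<^sub>m (n k) (n k))"

definition unit_on :: "(nat \<Rightarrow> nat) \<Rightarrow> nat set \<Rightarrow> nat \<Rightarrow> complex mat" where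
  "unit_on n I = restr n I (\<lambda>k. 1\<^sub>m (n k))"

definition clifford_seq :: "(nat \<Rightarrow> nat) \<Rightarrow> (nat \<Rightarrow> bool) \<Rightarrow> (nat \<Rightarrow> nat) \<Rightarrow> nat \<Rightarrow> complex mat" where
  "clifford_seq n b f = (\<lambda>k. clifford (n k) (b k) (f k))"

definition col_proj_seq :: "(nat \<Rightarrow> nat) \<Rightarrow> (nat \<Rightarrow> bool) \<Rightarrow> nat \<Rightarrow> complex mat" where
  "col_proj_seq n b = (\<lambda>k. col_proj (n k) (b k))"

lemma contractive_carrier: "contractive n a \<Longrightarrow> a k \<in> carrier_mat (n k) (n k)"
  by (simp add: contractive_def contraction_mat_def)

lemma contractive_imp_matrix_product: "contractive n a \<Longrightarrow> a \<in> matrix_product n"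
  unfolding matrix_product_def
  by (auto simp: contractive_carrier intro!: bdd_aboveI2[where M = 1] contraction_mat_op_norm)
    (auto simp: contractive_def)

lemma contractive_restr [simp]: "contractive n a \<Longrightarrow> contractive n (restr n I a)"
  by (simp add: contractive_def restr_def)

lemma contractive_adjoint_restr [simp]:
  "contractive n (\<lambda>k. mat_adjoint (a k)) \<Longrightarrow> contractive n (\<lambda>k. mat_adjoint (restr n I a k))"
  by (simp add: contractive_def restr_def)

lemma contractive_mult: "contractive n a \<Longrightarrow> contractive n b \<Longrightarrow> contractive n (\<lambda>k. a k * b k)"
  by (simp add: contractive_def contraction_mat_mult)

lemma contractive_seqs [simp]:
  "contractive n (unit_on n I)" "contractive n (\<lambda>k. mat_adjoint (unit_on n I k))"
  "contractive n (clifford_seq n b f)" "contractive n (\<lambda>k. mat_adjoint (clifford_seq n b f k))"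
  "contractive n (col_proj_seq n b)" "contractive n (\<lambda>k. mat_adjoint (col_proj_seq n b k))"
  by (simp_all add: contractive_def unit_on_def restr_def clifford_seq_def col_proj_seq_def)

text \<open>Only finitely many blocks are nonzero, so the norms are eventually 0. The ghost
  hypothesis enters through these units.\<close>

lemma matrix_c0_sum_unit_on: "unit_on n {..<K} \<in> matrix_c0_sum n"
proof -
  have "op_norm_mat (0\<^sub>m m m) = 0" for m
  proof -
    have "{l2_norm_vec (0\<^sub>m m m *\<^sub>v v) |v. v \<in> carrier_vec (dim_col (0\<^sub>m m m)) \<and> l2_norm_vec v \<le> 1} = {0}"
      (is "?S = _")
    proof
      show "?S \<subseteq> {0}" by (auto simp: l2_norm_vec_def L2_set_def scalar_prod_def)
      have "0 = l2_norm_vec (0\<^sub>m m m *\<^sub>v 0\<^sub>v m) \<and> 0\<^sub>v m \<in> carrier_vec (dim_col (0\<^sub>m m m)) \<and> l2_norm_vec (0\<^sub>v m) \<le> 1"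
        by (simp add: l2_norm_vec_def L2_set_def scalar_prod_def)
      then show "{0} \<subseteq> ?S" by blast
    qed
    then show ?thesis unfolding op_norm_mat_def by simp
  qed
  then have "\<forall>\<^sub>F k in sequentially. op_norm_mat (unit_on n {..<K} k) = 0"
    by (auto simp: unit_on_def restr_def eventually_sequentially intro!: exI[of _ K])
  then show ?thesis
    unfolding matrix_c0_sum_def by (simp add: contractive_imp_matrix_product tendsto_eventually)
qed

section \<open>Norms and inner products of images under the homomorphism\<close>

locale matrix_product_hom =
  fixes n :: "nat \<Rightarrow> nat" and \<Phi> :: "(nat \<Rightarrow> complex mat) \<Rightarrow> ('x ell2 \<Rightarrow>\<^sub>L 'x ell2)"
  assumes hom: "star_homomorphism n \<Phi>"
begin

abbreviation R :: "nat set \<Rightarrow> 'x ell2 \<Rightarrow> 'x ell2" where "R I \<equiv> blinfun_apply (\<Phi> (unit_on n I))"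

lemma phi_add:
  assumes "contractive n a" "contractive n b"
  shows "\<Phi> (\<lambda>k. a k + b k) v = \<Phi> a v + \<Phi> b v"
  using hom assms[THEN contractive_imp_matrix_product]
  by (simp add: star_homomorphism_def plus_blinfun.rep_eq)

lemma phi_uminus:
  assumes "contractive n a"
  shows "\<Phi> (\<lambda>k. (- 1) \<cdot>\<^sub>m a k) v = - \<Phi> a v"
  using hom contractive_imp_matrix_product[OF assms]
  unfolding star_homomorphism_def by (metis scaleC_minus_one)

text \<open>Stated for the whole product, because an arbitrary element is multiplied by the unit in
  the end.\<close>

lemma phi_mult:
  assumes "a \<in> matrix_product n" "b \<in> matrix_product n"
  shows "\<Phi> (\<lambda>k. a k * b k) v = \<Phi> a (\<Phi> b v)"
  using hom assms by (simp add: star_homomorphism_def)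

lemma phi_adjoint:
  assumes "contractive n a"
  shows "inner (\<Phi> (\<lambda>k. mat_adjoint (a k)) v) w = inner v (\<Phi> a w)"
  using hom contractive_imp_matrix_product[OF assms]
  by (simp add: star_homomorphism_def is_adjoint_def inner_ell2_def)

lemma phi_inner:
  assumes "contractive n a" "contractive n b" "contractive n (\<lambda>k. mat_adjoint (a k))"
  shows "inner (\<Phi> (\<lambda>k. mat_adjoint (a k) * b k) v) w = inner (\<Phi> b v) (\<Phi> a w)"
  using assms by (simp add: phi_mult contractive_imp_matrix_product phi_adjoint)

text \<open>By \<open>phi_inner\<close>, the norm of \<open>\<Phi> a v\<close> depends on
  \<open>a\<close> only through the adjoint of \<open>a\<close> times \<open>a\<close>.\<close>

lemma phi_norm_eq:
  assumes "contractive n a" "contractive n b" "contractive n (\<lambda>k. mat_adjoint (a k))"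
    "contractive n (\<lambda>k. mat_adjoint (b k))"
    and "\<And>k. mat_adjoint (a k) * a k = mat_adjoint (b k) * b k"
  shows "norm (\<Phi> a v) = norm (\<Phi> b v)"
  using phi_inner[of a a v v] phi_inner[of b b v v] assms by (simp add: norm_eq_sqrt_inner)

text \<open>The real inner product is symmetric, so anticommutation makes it equal to its own
  negative.\<close>

lemma phi_orthogonal:
  assumes "contractive n a" "contractive n b" "contractive n (\<lambda>k. mat_adjoint (a k))"
    "contractive n (\<lambda>k. mat_adjoint (b k))"
    and "\<And>k. mat_adjoint (a k) * b k = (- 1) \<cdot>\<^sub>m (mat_adjoint (b k) * a k)"
  shows "inner (\<Phi> a v) (\<Phi> b v) = 0"
proof -
  have "inner (\<Phi> b v) (\<Phi> a v) = inner (\<Phi> (\<lambda>k. mat_adjoint (a k) * b k) v) v"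
    using assms(1-3) by (rule phi_inner[symmetric])
  also have "\<dots> = - inner (\<Phi> (\<lambda>k. mat_adjoint (b k) * a k) v) v"
    using assms by (simp add: phi_uminus contractive_mult)
  also have "\<dots> = - inner (\<Phi> a v) (\<Phi> b v)" using assms by (simp add: phi_inner)
  finally show ?thesis by (simp add: inner_commute)
qed

lemma phi_projection:
  assumes "contractive n p" "\<And>k. mat_adjoint (p k) = p k" "\<And>k. p k * p k = p k"
  shows "inner (\<Phi> p v) (\<Phi> p v) = inner (\<Phi> p v) v"
  using phi_inner[of p p v v] assms by simp

lemma phi_projection_norm_le:
  assumes "contractive n p" "\<And>k. mat_adjoint (p k) = p k" "\<And>k. p k * p k = p k"
  shows "norm (\<Phi> p v) \<le> norm v"
proof -
  have "(norm (\<Phi> p v))\<^sup>2 = inner (\<Phi> p v) v"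
    using phi_projection[OF assms] by (simp add: power2_norm_eq_inner)
  also have "\<dots> \<le> norm (\<Phi> p v) * norm v" by (rule norm_cauchy_schwarz)
  finally have "norm (\<Phi> p v) * norm (\<Phi> p v) \<le> norm (\<Phi> p v) * norm v" by (simp add: power2_eq_square)
  then show ?thesis by (cases "norm (\<Phi> p v) = 0") (auto simp: mult_le_cancel_left)
qed

lemma phi_R:
  assumes "contractive n a"
  shows "\<Phi> a (R I v) = \<Phi> (restr n I a) v"
proof -
  have "(\<lambda>k. a k * unit_on n I k) = restr n I a"
    using right_mult_one_mat[OF contractive_carrier[OF assms]]
      right_mult_zero_mat[OF contractive_carrier[OF assms]]
    by (auto simp: unit_on_def restr_def fun_eq_iff)
  then show ?thesis
    using phi_mult[of a "unit_on n I" v] assms by (simp add: contractive_imp_matrix_product)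
qed

lemma R_R: "R I (R J v) = R (I \<inter> J) v"
proof -
  have "restr n J (unit_on n I) = unit_on n (I \<inter> J)"
    by (auto simp: unit_on_def restr_def)
  then show ?thesis by (simp add: phi_R)
qed

lemma R_Un:
  assumes "I \<inter> J = {}"
  shows "R (I \<union> J) v = R I v + R J v"
proof -
  have "unit_on n (I \<union> J) = (\<lambda>k. unit_on n I k + unit_on n J k)"
    using assms by (auto simp: unit_on_def restr_def fun_eq_iff)
  then show ?thesis by (simp add: phi_add)
qed

lemma unit_on_projection:
  "mat_adjoint (unit_on n I k) = unit_on n I k" "unit_on n I k * unit_on n I k = unit_on n I k"
  by (simp_all add: unit_on_def restr_def)

lemma R_inner: "inner (R I v) (R I v) = inner (R I v) v"
  by (rule phi_projection) (simp_all add: unit_on_projection)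

text \<open>\<open>\<Phi>\<close> may be non-unital, so \<open>R UNIV\<close> is only a projection;
  it still acts as a right unit on the image.\<close>

lemma phi_R_UNIV:
  assumes "contractive n a"
  shows "\<Phi> a (R UNIV v) = \<Phi> a v"
  using phi_R[OF assms, of UNIV v] by (simp add: restr_def)

section \<open>Clifford sequences on vectors carried by a set of blocks\<close>

lemma clifford_seq_orthogonal:
  assumes w: "R I w = w" and "\<And>k. k \<in> I \<Longrightarrow> f k \<noteq> g k"
  shows "inner (\<Phi> (clifford_seq n b f) w) (\<Phi> (clifford_seq n b g) w) = 0"
proof -
  \<comment> \<open>Truncation makes both sequences vanish on the blocks outside \<open>I\<close>,
    where \<open>f\<close> and \<open>g\<close> may agree and anticommutation may fail.\<close>
  have "inner (\<Phi> (restr n I (clifford_seq n b f)) w) (\<Phi> (restr n I (clifford_seq n b g)) w) = 0"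
  proof (rule phi_orthogonal)
    show "mat_adjoint (restr n I (clifford_seq n b f) k) * restr n I (clifford_seq n b g) k =
        (- 1) \<cdot>\<^sub>m (mat_adjoint (restr n I (clifford_seq n b g) k) * restr n I (clifford_seq n b f) k)" for k
      using assms(2) adjoint_clifford_anticommute[of "f k" "g k" "n k" "b k"]
      by (simp add: restr_def clifford_seq_def)
  qed simp_all
  then show ?thesis using phi_R[of "clifford_seq n b _" I w] w by simp
qed

lemma clifford_seq_norm_restr:
  assumes "\<And>k. k \<in> I \<Longrightarrow> f k < floor_log (n k)"
  shows "norm (\<Phi> (restr n I (clifford_seq n b f)) v) = norm (\<Phi> (restr n I (col_proj_seq n b)) v)"
proof (rule phi_norm_eq)
  show "mat_adjoint (restr n I (clifford_seq n b f) k) * restr n I (clifford_seq n b f) k =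
      mat_adjoint (restr n I (col_proj_seq n b) k) * restr n I (col_proj_seq n b) k" for k
    using assms by (simp add: restr_def clifford_seq_def col_proj_seq_def adjoint_clifford_mult_self)
qed simp_all

lemma clifford_seq_norm:
  assumes w: "R I w = w" and "\<And>k. k \<in> I \<Longrightarrow> f k < floor_log (n k)"
  shows "norm (\<Phi> (clifford_seq n b f) w) = norm (\<Phi> (col_proj_seq n b) w)"
  using clifford_seq_norm_restr[of I f b w, OF assms(2)] phi_R[of "clifford_seq n b f" I w]
    phi_R[of "col_proj_seq n b" I w] w by simp

text \<open>Blocks with an index out of range carry the zero matrix, so \<open>f\<close> can be
  arbitrary. On the others the norm is that of a projection applied to \<open>v\<close>.\<close>

lemma clifford_seq_norm_le: "norm (\<Phi> (clifford_seq n b f) v) \<le> norm v"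
proof -
  let ?J = "{k. f k < floor_log (n k)}"
  have "restr n ?J (clifford_seq n b f) = clifford_seq n b f"
    by (auto simp: restr_def clifford_seq_def clifford_eq_zero)
  then have "norm (\<Phi> (clifford_seq n b f) v) = norm (\<Phi> (restr n ?J (col_proj_seq n b)) v)"
    using clifford_seq_norm_restr[of ?J f b v] by simp
  also have "\<dots> \<le> norm v"
    by (rule phi_projection_norm_le) (simp, simp_all add: restr_def col_proj_seq_def)
  finally show ?thesis .
qed

lemma col_proj_seq_split:
  assumes w: "R I w = w"
  shows "\<Phi> (col_proj_seq n (\<lambda>_. False)) w + \<Phi> (col_proj_seq n (\<lambda>_. True)) w = w"
proof -
  have "(\<lambda>k. col_proj_seq n (\<lambda>_. False) k + col_proj_seq n (\<lambda>_. True) k) = unit_on n UNIV"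
    using col_proj_add[of _ False] by (simp add: col_proj_seq_def unit_on_def restr_def)
  then have "\<Phi> (col_proj_seq n (\<lambda>_. False)) w + \<Phi> (col_proj_seq n (\<lambda>_. True)) w = R UNIV w"
    by (metis phi_add contractive_seqs(5))
  also have "\<dots> = w" using R_R[of UNIV I w] w by simp
  finally show ?thesis .
qed

section \<open>Strong convergence of the tail units to zero\<close>

text \<open>Multiples of different reals have eventually different integer parts, which makes the
  images of the limit \<open>\<zeta>\<close> under the corresponding Clifford sequences an uncountable orthogonal family.\<close>

lemma R_tail_tendsto_zero:
  assumes countable: "countable (UNIV :: 'x set)" and n: "filterlim n at_top sequentially"
  shows "(\<lambda>K. R {K..} v) \<longlonglongrightarrow> 0"
proof -
  let ?r = "\<lambda>K. R {K..} v"
  have RR: "R {K..} (?r L) = ?r (max K L)" for K L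
  proof -
    have "{K..} \<inter> {L..} = {max K L..}" by auto
    then show ?thesis by (simp add: R_R)
  qed
  \<comment> \<open>Pythagoras for decreasing projections: convergence of the squared norms makes
    the vectors themselves Cauchy.\<close>
  have diff: "(norm (?r K - ?r L))\<^sup>2 = (norm (?r K))\<^sup>2 - (norm (?r L))\<^sup>2" if "K \<le> L" for K L
  proof -
    have "inner (?r L) (?r K) = inner (?r L) (?r L)"
      using R_inner[of "{L..}" "?r K"] RR[of L K] that by (simp add: max_absorb1)
    then show ?thesis
      by (simp add: power2_norm_eq_inner inner_diff_left inner_diff_right inner_commute)
  qed
  have "decseq (\<lambda>K. (norm (?r K))\<^sup>2)"
    unfolding decseq_def using diff by (metis diff_ge_0_iff_ge zero_le_power2)
  then obtain l where l: "(\<lambda>K. (norm (?r K))\<^sup>2) \<longlonglongrightarrow> l"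
    using decseq_convergent[of _ 0] by (metis zero_le_power2)
  have "Cauchy ?r"
  proof (rule metric_CauchyI)
    fix e :: real assume "0 < e"
    then have "0 < e\<^sup>2" by simp
    with LIMSEQ_imp_Cauchy[OF l] obtain M where
      M: "dist ((norm (?r K))\<^sup>2) ((norm (?r L))\<^sup>2) < e\<^sup>2" if "M \<le> K" "M \<le> L" for K L
      by (meson metric_CauchyD)
    have le: "norm (?r K - ?r L) < e" if "M \<le> K" "K \<le> L" for K L
    proof -
      have "(norm (?r K - ?r L))\<^sup>2 < e\<^sup>2"
        using M[of K L] that by (simp add: diff[OF \<open>K \<le> L\<close>] dist_real_def)
      then show ?thesis using \<open>0 < e\<close> by (simp add: power2_less_imp_less)
    qed
    show "\<exists>M. \<forall>K\<ge>M. \<forall>L\<ge>M. dist (?r K) (?r L) < e"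
      using le by (intro exI[of _ M]) (metis dist_norm dist_commute nat_le_linear)
  qed
  then obtain \<zeta> where \<zeta>: "?r \<longlonglongrightarrow> \<zeta>" using Cauchy_convergent_iff convergent_def by blast
  have R\<zeta>: "R {K..} \<zeta> = \<zeta>" for K
  proof (rule LIMSEQ_unique)
    show "(\<lambda>L. R {K..} (?r L)) \<longlonglongrightarrow> R {K..} \<zeta>" by (intro blinfun.tendsto tendsto_const \<zeta>)
    have "\<forall>\<^sub>F L in sequentially. ?r L = R {K..} (?r L)"
      using eventually_ge_at_top[of K] by eventually_elim (simp add: RR max_absorb2)
    then show "(\<lambda>L. R {K..} (?r L)) \<longlonglongrightarrow> \<zeta>" by (rule Lim_transform_eventually[OF \<zeta>])
  qed
  have fl: "filterlim (\<lambda>k. floor_log (n k)) at_top sequentially"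
  proof -
    have "\<forall>\<^sub>F k in sequentially. m \<le> floor_log (n k)" for m
      using filterlim_at_top[THEN iffD1, OF n, rule_format, of "2 ^ m"]
      by eventually_elim (metis floor_log_le_iff floor_log_power)
    then show ?thesis by (simp add: filterlim_at_top)
  qed
  define f where "f \<alpha> k = nat \<lfloor>\<alpha> * real (floor_log (n k))\<rfloor>" for \<alpha> k
  have zero: "\<Phi> (col_proj_seq n (\<lambda>_. b)) \<zeta> = 0" for b
  proof -
    obtain K0 where K0: "\<And>k. k \<ge> K0 \<Longrightarrow> 1 \<le> floor_log (n k)"
      using fl unfolding filterlim_at_top eventually_sequentially by blast
    have "(norm (\<Phi> (col_proj_seq n (\<lambda>_. b)) \<zeta>))\<^sup>2 = 0"
    proof (rule no_uncountable_orthogonal_family[OF countable])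
      \<comment> \<open>Slopes below 1 keep \<open>f \<alpha> k\<close> below
        \<open>floor_log (n k)\<close> once that is at least 1; this makes all norms equal.\<close>
      show "uncountable {0<..<1 :: real}" by (simp add: uncountable_open_interval)
      have orth: "inner (\<Phi> (clifford_seq n (\<lambda>_. b) (f \<alpha>)) \<zeta>) (\<Phi> (clifford_seq n (\<lambda>_. b) (f \<beta>)) \<zeta>) = 0"
        if "0 < \<alpha>" "\<alpha> < \<beta>" for \<alpha> \<beta>
      proof -
        \<comment> \<open>From \<open>K\<close> on the two multiples differ by at least 1, hence so
          do their floors. The limit is fixed by \<open>R {K..}\<close>, so earlier blocks do not
          matter.\<close>
        obtain K where K: "\<And>k. k \<ge> K \<Longrightarrow> nat \<lceil>1 / (\<beta> - \<alpha>)\<rceil> \<le> floor_log (n k)"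
          using fl unfolding filterlim_at_top eventually_sequentially by blast
        have "f \<alpha> k \<noteq> f \<beta> k" if "k \<in> {K..}" for k
        proof -
          let ?m = "real (floor_log (n k))"
          have "1 / (\<beta> - \<alpha>) \<le> ?m" using K[of k] that by (simp add: nat_ceiling_le_eq)
          then have "\<alpha> * ?m + 1 \<le> \<beta> * ?m" using \<open>\<alpha> < \<beta>\<close> by (simp add: field_simps)
          then have "\<lfloor>\<alpha> * ?m\<rfloor> < \<lfloor>\<beta> * ?m\<rfloor>" by linarith
          moreover have "0 \<le> \<lfloor>\<alpha> * ?m\<rfloor>" using \<open>0 < \<alpha>\<close> by simp
          ultimately show ?thesis unfolding f_def by linarith
        qed
        then show ?thesis by (intro clifford_seq_orthogonal[OF R\<zeta>[of K]]) auto
      qed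
      show "inner (\<Phi> (clifford_seq n (\<lambda>_. b) (f \<alpha>)) \<zeta>) (\<Phi> (clifford_seq n (\<lambda>_. b) (f \<beta>)) \<zeta>) = 0"
        if "\<alpha> \<in> {0<..<1}" "\<beta> \<in> {0<..<1}" "\<alpha> \<noteq> \<beta>" for \<alpha> \<beta>
        using orth[of \<alpha> \<beta>] orth[of \<beta> \<alpha>] that by (cases "\<alpha> < \<beta>") (auto simp: inner_commute)
      show "(norm (\<Phi> (clifford_seq n (\<lambda>_. b) (f \<alpha>)) \<zeta>))\<^sup>2 = (norm (\<Phi> (col_proj_seq n (\<lambda>_. b)) \<zeta>))\<^sup>2"
        if "\<alpha> \<in> {0<..<1}" for \<alpha>
      proof -
        have "f \<alpha> k < floor_log (n k)" if k: "k \<in> {K0..}" for k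
        proof -
          have "\<alpha> * real (floor_log (n k)) < real (floor_log (n k))"
            using K0[of k] k \<open>\<alpha> \<in> {0<..<1}\<close> by simp
          then have "\<lfloor>\<alpha> * real (floor_log (n k))\<rfloor> < int (floor_log (n k))"
            by (simp add: floor_less_iff)
          then show ?thesis using K0[of k] k unfolding f_def by simp
        qed
        then show ?thesis
          using clifford_seq_norm[OF R\<zeta>[of K0], of "f \<alpha>" "\<lambda>_. b"] by simp
      qed
    qed
    then show ?thesis by simp
  qed
  have "\<zeta> = 0" using col_proj_seq_split[OF R\<zeta>[of 0]] zero by simp
  with \<zeta> show ?thesis by simp
qed

text \<open>The order of choices matters: \<open>a\<close> is fixed first, which is possible as
  \<open>N\<close> bounds \<open>B x\<close> for all \<open>x\<close> at once; then
  \<open>x\<close>, where the head below \<open>a\<close> is small by the ghost property; then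
  \<open>b\<close>, where the tail at this \<open>x\<close> is small; last the family
  \<open>\<beta>\<close> and the index \<open>i\<close>.\<close>

lemma ex_spreading_block:
  assumes countable: "countable (UNIV :: 'x set)" and n: "filterlim n at_top sequentially"
    and ghost: "\<And>K. ghost (\<Phi> (unit_on n {..<K}))"
    and bad: "\<And>F. finite F \<Longrightarrow> \<exists>x. x \<notin> F \<and> \<epsilon> \<le> norm (R UNIV (delta x))"
    and "0 < \<delta>" and B: "\<And>x. finite (B x) \<and> card (B x) \<le> N"
  shows "\<exists>a b x \<beta> i. K \<le> a \<and> a < b \<and> norm (R {..<a} (delta x)) < \<delta> \<and> norm (R {b..} (delta x)) < \<delta> \<and>
    (\<epsilon> - 2 * \<delta>) / 4 \<le> norm (chi (- B x) (\<Phi> (clifford_seq n (\<lambda>_. \<beta>) (\<lambda>_. i)) (R {a..<b} (delta x))))"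
proof -
  \<comment> \<open>Enough vectors for \<open>ex_small_on_finite_set\<close>; \<open>Suc\<close>
    keeps \<open>M\<close> positive when \<open>N = 0\<close>.\<close>
  define M where "M = Suc (8 * N)"
  obtain K' where K': "\<And>k. k \<ge> K' \<Longrightarrow> 2 ^ M \<le> n k"
    using n unfolding filterlim_at_top eventually_sequentially by blast
  define a where "a = max K K'"
  have fl: "M \<le> floor_log (n k)" if "a \<le> k" for k
    using floor_log_le_iff[OF K'[of k]] that by (simp add: a_def)
  obtain F where F: "finite F" "\<And>x. x \<notin> F \<Longrightarrow> norm (R {..<a} (delta x)) < \<delta>"
    using ghost[of a] \<open>0 < \<delta>\<close> unfolding ghost_def by blast
  obtain x where x: "x \<notin> F" "\<epsilon> \<le> norm (R UNIV (delta x))" using bad[OF F(1)] by blast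
  have "\<forall>\<^sub>F b in sequentially. norm (R {b..} (delta x)) < \<delta>"
    using R_tail_tendsto_zero[OF countable n] \<open>0 < \<delta>\<close> by (simp add: tendsto_iff dist_norm)
  then have "\<forall>\<^sub>F b in sequentially. a < b \<and> norm (R {b..} (delta x)) < \<delta>"
    using eventually_gt_at_top[of a] by eventually_elim simp
  then obtain b where b: "a < b" "norm (R {b..} (delta x)) < \<delta>"
    unfolding eventually_sequentially by blast
  let ?w = "R {a..<b} (delta x)"
  have w: "R {a..<b} ?w = ?w" by (simp add: R_R)
  have "UNIV = {..<a} \<union> ({a..<b} \<union> {b..})" using b(1) by auto
  then have "R UNIV (delta x) = R {..<a} (delta x) + (?w + R {b..} (delta x))"
    using b(1) R_Un[of "{..<a}" "{a..<b} \<union> {b..}"] R_Un[of "{a..<b}" "{b..}"] by fastforce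
  then have w_norm: "\<epsilon> - 2 * \<delta> \<le> norm ?w"
    using x(2) F(2)[OF x(1)] b(2) norm_triangle_ineq[of "R {..<a} (delta x)" "?w + R {b..} (delta x)"]
      norm_triangle_ineq[of ?w "R {b..} (delta x)"] by simp
  \<comment> \<open>One of the two column families keeps half of the norm, and leaving
    \<open>B x\<close> costs another half; hence the quarter.\<close>
  have "norm ?w \<le> norm (\<Phi> (col_proj_seq n (\<lambda>_. False)) ?w) + norm (\<Phi> (col_proj_seq n (\<lambda>_. True)) ?w)"
    using norm_triangle_ineq col_proj_seq_split[OF w] by metis
  then have "(\<epsilon> - 2 * \<delta>) / 2 \<le> norm (\<Phi> (col_proj_seq n (\<lambda>_. False)) ?w) \<or>
      (\<epsilon> - 2 * \<delta>) / 2 \<le> norm (\<Phi> (col_proj_seq n (\<lambda>_. True)) ?w)"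
    using w_norm by (auto simp: field_simps not_le)
  then obtain \<beta> where \<beta>: "(\<epsilon> - 2 * \<delta>) / 2 \<le> norm (\<Phi> (col_proj_seq n (\<lambda>_. \<beta>)) ?w)"
    by blast
  let ?u = "\<lambda>i. \<Phi> (clifford_seq n (\<lambda>_. \<beta>) (\<lambda>_. i)) ?w"
  have norm_u: "norm (?u i) = norm (\<Phi> (col_proj_seq n (\<lambda>_. \<beta>)) ?w)" if "i < M" for i
    using fl that by (intro clifford_seq_norm[OF w]) (simp add: less_le_trans)
  have "8 * card (B x) \<le> M" using B[of x] by (simp add: M_def)
  then obtain i where i: "i < M" "norm (chi (B x) (?u i)) \<le> norm (?u i) / 2"
    using ex_small_on_finite_set[of "B x" M ?u "norm (\<Phi> (col_proj_seq n (\<lambda>_. \<beta>)) ?w)"] B[of x]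
      clifford_seq_orthogonal[OF w] norm_u by (auto simp: M_def)
  have "norm (?u i) \<le> norm (chi (B x) (?u i)) + norm (chi (- B x) (?u i))"
    using norm_triangle_ineq chi_Compl by metis
  then have "(\<epsilon> - 2 * \<delta>) / 4 \<le> norm (chi (- B x) (?u i))"
    using i \<beta> norm_u[OF i(1)] by simp
  then show ?thesis using b F(2)[OF x(1)] by (intro exI[of _ a] exI[of _ b] exI[of _ x] exI) (auto simp: a_def)
qed

end

theorem theorem1p8:
  fixes n :: "nat \<Rightarrow> nat"
    and \<Phi> :: "(nat \<Rightarrow> complex mat) \<Rightarrow> ('a::metric_space ell2 \<Rightarrow>\<^sub>L 'a ell2)"
  assumes "infinite (UNIV :: 'a set)"
    and "uniformly_locally_finite TYPE('a)"
    and "filterlim n at_top sequentially"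
    and "\<Phi> ` matrix_product n \<subseteq> quasi_local_algebra"
    and "star_homomorphism n \<Phi>"
    and "inj_on \<Phi> (matrix_product n)"
    and "\<forall>a\<in>matrix_c0_sum n. ghost (\<Phi> a)"
  shows "\<forall>a\<in>matrix_product n. ghost (\<Phi> a)"
proof -
  interpret matrix_product_hom n \<Phi> by unfold_locales (rule assms)
  have balls: "\<exists>N. \<forall>x::'a. finite (cball x r) \<and> card (cball x r) \<le> N" if "0 < r" for r
    using assms(2) that by (simp add: uniformly_locally_finite_def)
  have countable: "countable (UNIV :: 'a set)"
  proof -
    fix x0 :: 'a
    have "finite (cball x0 (real (Suc k)))" for k using balls[of "real (Suc k)"] by auto
    then have "countable (\<Union>k. cball x0 (real (Suc k)))" by (intro countable_UN) (auto intro: countable_finite)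
    moreover have "(\<Union>k. cball x0 (real (Suc k))) = UNIV"
    proof -
      have "\<exists>k. dist x0 x \<le> real (Suc k)" for x
        using real_arch_simple[of "dist x0 x"] by (metis of_nat_Suc add_increasing2 le_add1 order_trans of_nat_le_iff Suc_eq_plus1)
      then show ?thesis by auto
    qed
    ultimately show ?thesis by simp
  qed
  have bounded_op: "\<Phi> a \<in> bounded_operators" if "a \<in> matrix_product n" for a
    using assms(4) that by (auto simp: quasi_local_algebra_def)
  have unit: "unit_on n UNIV \<in> matrix_product n" by (simp add: contractive_imp_matrix_product)
  have ghost_unit: "ghost (\<Phi> (unit_on n UNIV))"
  proof (rule ccontr)
    assume "\<not> ghost (\<Phi> (unit_on n UNIV))"
    then obtain \<epsilon> where "0 < \<epsilon>"
      and bad: "\<And>F. finite F \<Longrightarrow> \<exists>x. x \<notin> F \<and> \<epsilon> \<le> norm (R UNIV (delta x))"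
      unfolding ghost_def using bounded_op[OF unit] by (meson not_less)
    \<comment> \<open>With this choice \<open>(\<epsilon> - 2 * \<delta>) / 4\<close> is
      \<open>7 * \<epsilon> / 32\<close>, more than the \<open>3 * \<delta>\<close>, that is
      \<open>6 * \<epsilon> / 32\<close>, of the three error terms at the end.\<close>
    define \<delta> where "\<delta> = \<epsilon> / 16"
    have "0 < \<delta>" using \<open>0 < \<epsilon>\<close> by (simp add: \<delta>_def)
    have "\<exists>a b x \<beta> i. K \<le> a \<and> a < b \<and> norm (R {..<a} (delta x)) < \<delta> \<and> norm (R {b..} (delta x)) < \<delta> \<and>
        (\<epsilon> - 2 * \<delta>) / 4 \<le> norm (chi (- cball x (real (Suc j)))
          (\<Phi> (clifford_seq n (\<lambda>_. \<beta>) (\<lambda>_. i)) (R {a..<b} (delta x))))" for K j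
    proof -
      obtain N where N: "\<And>x::'a. finite (cball x (real (Suc j))) \<and> card (cball x (real (Suc j))) \<le> N"
        using balls[of "real (Suc j)"] by auto
      show ?thesis
        using assms(7) matrix_c0_sum_unit_on
        by (intro ex_spreading_block[OF countable assms(3) _ bad \<open>0 < \<delta>\<close> N]) auto
    qed
    then obtain a b :: "nat \<Rightarrow> nat \<Rightarrow> nat" and x :: "nat \<Rightarrow> nat \<Rightarrow> 'a" and \<beta> i where
      block: "\<And>K j. K \<le> a K j \<and> a K j < b K j \<and> norm (R {..<a K j} (delta (x K j))) < \<delta> \<and>
        norm (R {b K j..} (delta (x K j))) < \<delta> \<and>
        (\<epsilon> - 2 * \<delta>) / 4 \<le> norm (chi (- cball (x K j) (real (Suc j)))
          (\<Phi> (clifford_seq n (\<lambda>_. \<beta> K j) (\<lambda>_. i K j)) (R {a K j..<b K j} (delta (x K j)))))"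
      by metis
    \<comment> \<open>Stage \<open>j\<close> starts at \<open>s j\<close>, and its block ends at
      \<open>s (Suc j)\<close>, so the blocks are disjoint.\<close>
    define s where "s = rec_nat 0 (\<lambda>j K. b K j)"
    have s_Suc: "s (Suc j) = b (s j) j" for j by (simp add: s_def)
    have "strict_mono s"
      using block by (intro strict_monoI_Suc) (metis s_Suc le_less_trans)
    \<comment> \<open>\<open>J k\<close> is the stage whose interval from \<open>s j\<close> to
      below \<open>s (Suc j)\<close> contains \<open>k\<close>.\<close>
    define J where "J k = (LEAST j. k < s (Suc j))" for k
    have J: "J k = j" if "s j \<le> k" "k < s (Suc j)" for j k
      unfolding J_def
    proof (rule Least_equality)
      fix j' assume "k < s (Suc j')"
      then have "s j < s (Suc j')" using that(1) by simp
      then show "j \<le> j'" using \<open>strict_mono s\<close> by (simp add: strict_mono_less)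
    qed (use that in simp)
    define u where "u = clifford_seq n (\<lambda>k. \<beta> (s (J k)) (J k)) (\<lambda>k. i (s (J k)) (J k))"
    have u: "contractive n u" by (simp add: u_def)
    then have "\<Phi> u \<in> quasi_local_algebra" using assms(4) contractive_imp_matrix_product by blast
    then obtain r where r: "\<And>A B. setdist A B > r \<Longrightarrow> norm (chi A o\<^sub>L \<Phi> u o\<^sub>L chi B) \<le> \<delta>"
      unfolding quasi_local_algebra_def using \<open>0 < \<delta>\<close> by blast
    obtain j where j: "r < real j" using reals_Archimedean2 by blast
    define y where "y = x (s j) j"
    define I where "I = {a (s j) j..<b (s j) j}"
    let ?A = "- cball y (real (Suc j))" and ?L = "{..<a (s j) j}" and ?U = "{b (s j) j..}"
    have "finite (cball y (real (Suc j)))" using balls[of "real (Suc j)"] by auto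
    \<comment> \<open>An infinite space is not covered by a finite ball. For an empty
      \<open>?A\<close>, \<open>setdist\<close> would be 0 and quasi-locality could not be
      applied.\<close>
    then have "?A \<noteq> {}" using assms(1) by (metis Compl_eq_Diff_UNIV Diff_eq_empty_iff rev_finite_subset)
    then have "real (Suc j) \<le> setdist ?A {y}"
      by (intro le_setdistI) (auto simp: dist_commute)
    then have "norm (chi ?A o\<^sub>L \<Phi> u o\<^sub>L chi {y}) \<le> \<delta>" using j by (intro r) simp
    moreover have "chi {y} (delta y) = delta y" unfolding chi_apply by transfer auto
    then have "(chi ?A o\<^sub>L \<Phi> u o\<^sub>L chi {y}) (delta y) = chi ?A (\<Phi> u (delta y))" by simp
    ultimately have small: "norm (chi ?A (\<Phi> u (delta y))) \<le> \<delta>"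
      using norm_blinfun[of "chi ?A o\<^sub>L \<Phi> u o\<^sub>L chi {y}" "delta y"] by simp
    have "restr n I u = restr n I (clifford_seq n (\<lambda>_. \<beta> (s j) j) (\<lambda>_. i (s j) j))"
    proof
      fix k
      have "J k = j" if "k \<in> I"
        using that block[of "s j" j] by (intro J) (auto simp: I_def s_Suc)
      then show "restr n I u k = restr n I (clifford_seq n (\<lambda>_. \<beta> (s j) j) (\<lambda>_. i (s j) j)) k"
        by (simp add: restr_def u_def clifford_seq_def)
    qed
    then have large: "(\<epsilon> - 2 * \<delta>) / 4 \<le> norm (chi ?A (\<Phi> u (R I (delta y))))"
      using block[where K = "s j" and j = j] u by (simp add: phi_R y_def I_def)
    have triangle: "norm w \<le> norm p + norm l + norm t" if "w = p - l - t" for w p l t :: "'a ell2"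
      using norm_triangle_ineq4[of "p - l" t] norm_triangle_ineq4[of p l] that by simp
    \<comment> \<open>Only the middle part is known to be spread; the head and the tail are errors
      below \<open>\<delta>\<close>, since \<open>\<Phi> u\<close> is contractive.\<close>
    have "\<Phi> u (delta y) = \<Phi> u (R ?L (delta y)) + (\<Phi> u (R I (delta y)) + \<Phi> u (R ?U (delta y)))"
    proof -
      have ab: "a (s j) j < b (s j) j" using block by blast
      then have "UNIV = ?L \<union> (I \<union> ?U)" by (auto simp: I_def)
      then have "R UNIV (delta y) = R ?L (delta y) + (R I (delta y) + R ?U (delta y))"
        using ab R_Un[of ?L "I \<union> ?U"] R_Un[of I ?U] by (fastforce simp: I_def)
      then show ?thesis using phi_R_UNIV[OF u, of "delta y"] by (simp add: blinfun.add_right)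
    qed
    then have "chi ?A (\<Phi> u (R I (delta y))) =
        chi ?A (\<Phi> u (delta y)) - chi ?A (\<Phi> u (R ?L (delta y))) - chi ?A (\<Phi> u (R ?U (delta y)))"
      by (simp add: blinfun.add_right)
    then have "norm (chi ?A (\<Phi> u (R I (delta y)))) \<le>
        norm (chi ?A (\<Phi> u (delta y))) + norm (chi ?A (\<Phi> u (R ?L (delta y)))) + norm (chi ?A (\<Phi> u (R ?U (delta y))))"
      by (rule triangle)
    moreover have "norm (chi ?A (\<Phi> u (R S (delta y)))) \<le> norm (R S (delta y))" for S
      unfolding u_def by (rule order_trans[OF norm_chi_le clifford_seq_norm_le])
    ultimately have "(\<epsilon> - 2 * \<delta>) / 4 \<le> \<delta> + norm (R ?L (delta y)) + norm (R ?U (delta y))"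
      using small large by (meson add_mono order_trans order_refl)
    moreover have "norm (R ?L (delta y)) < \<delta>" "norm (R ?U (delta y)) < \<delta>"
      using block unfolding y_def by blast+
    ultimately show False using \<open>0 < \<epsilon>\<close> by (simp add: \<delta>_def)
  qed
  show ?thesis
  proof
    fix a assume a: "a \<in> matrix_product n"
    then have "(\<lambda>k. a k * unit_on n UNIV k) = a"
      by (auto simp: unit_on_def restr_def matrix_product_def fun_eq_iff intro: right_mult_one_mat)
    then have *: "\<Phi> a v = \<Phi> a (R UNIV v)" for v using phi_mult[OF a unit] by simp
    show "ghost (\<Phi> a)"
      unfolding ghost_def
    proof (intro conjI allI impI)
      fix e :: real assume "0 < e"
      \<comment> \<open>Adding 1 avoids division by zero when \<open>\<Phi> a\<close>
        vanishes.\<close>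
      have c: "0 < norm (\<Phi> a) + 1" by (simp add: add_nonneg_pos)
      then have "0 < e / (norm (\<Phi> a) + 1)" using \<open>0 < e\<close> by simp
      then obtain F where "finite F"
        and F: "\<And>x. x \<notin> F \<Longrightarrow> norm (R UNIV (delta x)) < e / (norm (\<Phi> a) + 1)"
        using ghost_unit unfolding ghost_def by blast
      have "norm (\<Phi> a (delta x)) < e" if "x \<notin> F" for x
      proof -
        have "norm (\<Phi> a (delta x)) \<le> norm (\<Phi> a) * norm (R UNIV (delta x))"
          unfolding *[of "delta x"] by (rule norm_blinfun)
        also have "\<dots> \<le> (norm (\<Phi> a) + 1) * norm (R UNIV (delta x))"
          by (rule mult_right_mono) simp_all
        also have "\<dots> < e" using F[OF that] c by (simp add: pos_less_divide_eq mult.commute)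
        finally show ?thesis .
      qed
      with \<open>finite F\<close> show "\<exists>F. finite F \<and> (\<forall>x. x \<notin> F \<longrightarrow> norm (\<Phi> a (delta x)) < e)" by blast
    qed (rule bounded_op[OF a])
  qed
qed

end
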